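(* Let $\Sigma=\{1,\dots,\sigma\}$ and let $1\le k\le n$ be integers. There exists an exact circular $k$-mismatch sketch ($k$-ECS) for $\Sigma^n$ of size $\tilde{O}(k)$.
   Context: Strings $S\in\Sigma^n$ are written $S[1]S[2]\cdots S[n]$. $\mathsf{Ham}(S,T)=|\{i\in[n]: S[i]\ne T[i]\}|$ for $S,T\in\Sigma^n$. $\mathsf{cyc}(S)=S[2]\cdots S[n]S[1]$ and $\mathsf{cyc}^m$ denotes its $m$-fold iterate for $m\in\mathbb{Z}$ (negative $m$ meaning the inverse rotation). A randomized function $X\to Y$ is a random variable whose values are functions $X\to Y$; in a sketch, a single random draw of the encoding function is applied to both strings (shared randomness). "With high probability" means with probability at least $1-n^{-\Omega(1)}$. $\tilde O(\cdot)$ suppresses $\log^{O(1)} n$ factors. A $k$-ECS for $\Pi\subseteq\Sigma^n$ is a pair of randomized functions $\mathtt{sk}:\Pi\to\{0,1\}^*$ and $\mathtt{dec}:\{0,1\}^*\times\{0,1\}^*\times\mathbb{Z}\to\mathbb{N}$ such that for every $S_1,S_2\in\Pi$ and $m\in\mathbb{Z}$, with high probability: if $\mathsf{Ham}(S_1,\mathsf{cyc}^m(S_2))\le k$ then $\mathtt{dec}(\mathtt{sk}(S_1),\mathtt{sk}(S_2),m)=\mathsf{Ham}(S_1,\mathsf{cyc}^m(S_2))$, and otherwise $\mathtt{dec}(\mathtt{sk}(S_1),\mathtt{sk}(S_2),m)>k$. A sketch for $\Pi$ has size $s$ if for every $S\in\Pi$, $|\mathtt{sk}(S)|\le s$ with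 high probability. *)

theory Defs
  imports "HOL-Probability.Probability"
begin

definition strings :: "'a set \<Rightarrow> nat \<Rightarrow> 'a list set" where
  "strings \<Sigma> n = {S. set S \<subseteq> \<Sigma> \<and> length S = n}"

text \<open>Only used for lists of equal length.\<close>
definition Ham :: "'a list \<Rightarrow> 'a list \<Rightarrow> nat" where
  "Ham S T = card {i. i < length S \<and> S ! i \<noteq> T ! i}"

text \<open>\<^const>\<open>rotate1\<close> sends \<open>S[1]S[2]\<dots>S[n]\<close> to \<open>S[2]\<dots>S[n]S[1]\<close>, and it is a bijection on lists.\<close>
definition cyc_pow :: "int \<Rightarrow> 'a list \<Rightarrow> 'a list" where
  "cyc_pow m = (if 0 \<le> m then rotate1 ^^ nat m else inv rotate1 ^^ nat (- m))"

text \<open>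
  A random variable on the probability space \<open>M\<close> whose values are functions on \<open>X\<close>. The
  \<open>\<sigma>\<close>-algebra on the function space is the product one, that is, every evaluation at a point of
  \<open>X\<close> is measurable; the codomains occurring below are countable and carry the discrete
  \<open>\<sigma>\<close>-algebra.
\<close>
definition randomized_function :: "'w measure \<Rightarrow> 'x set \<Rightarrow> ('w \<Rightarrow> 'x \<Rightarrow> 'y) \<Rightarrow> bool" where
  "randomized_function M X f \<longleftrightarrow>
     prob_space M \<and> (\<forall>x\<in>X. (\<lambda>\<omega>. f \<omega> x) \<in> measurable M (count_space UNIV))"

text \<open>
  The constant hidden in the \<open>\<Omega>(1)\<close> of the probability \<open>1 - n\<^bsup>-\<Omega>(1)\<^esup>\<close> is the explicit parameter
  \<open>c\<close>.
\<close>
definition whp :: "real \<Rightarrow> nat \<Rightarrow> 'w measure \<Rightarrow> ('w \<Rightarrow> bool) \<Rightarrow> bool" where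
  "whp c n M E \<longleftrightarrow> measure M {\<omega> \<in> space M. E \<omega>} \<ge> 1 - real n powr (- c)"

text \<open>
  The same \<open>\<omega>\<close> is used for both encodings and for the decoder: the randomness is shared.
\<close>
definition ECS ::
  "real \<Rightarrow> nat \<Rightarrow> nat \<Rightarrow> 'a list set \<Rightarrow> 'w measure
     \<Rightarrow> ('w \<Rightarrow> 'a list \<Rightarrow> bool list) \<Rightarrow> ('w \<Rightarrow> bool list \<times> bool list \<times> int \<Rightarrow> nat) \<Rightarrow> bool" where
  "ECS c n k P M sk dec \<longleftrightarrow>
     randomized_function M P sk \<and> randomized_function M UNIV dec \<and>
     (\<forall>S\<^sub>1\<in>P. \<forall>S\<^sub>2\<in>P. \<forall>m::int.
        whp c n M (\<lambda>\<omega>.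
          if Ham S\<^sub>1 (cyc_pow m S\<^sub>2) \<le> k
          then dec \<omega> (sk \<omega> S\<^sub>1, sk \<omega> S\<^sub>2, m) = Ham S\<^sub>1 (cyc_pow m S\<^sub>2)
          else dec \<omega> (sk \<omega> S\<^sub>1, sk \<omega> S\<^sub>2, m) > k))"

definition sketch_size ::
  "real \<Rightarrow> nat \<Rightarrow> 'a list set \<Rightarrow> 'w measure \<Rightarrow> ('w \<Rightarrow> 'a list \<Rightarrow> bool list) \<Rightarrow> real \<Rightarrow> bool" where
  "sketch_size c n P M sk s \<longleftrightarrow>
     (\<forall>S\<in>P. whp c n M (\<lambda>\<omega>. real (length (sk \<omega> S)) \<le> s))"

text \<open>
  A joint draw of an encoder and a decoder. Taking this as the sample space is no restriction,
  since the joint law of any pair of randomized functions lives on it.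
\<close>
type_synonym 'a coder_pair = "('a list \<Rightarrow> bool list) \<times> (bool list \<times> bool list \<times> int \<Rightarrow> nat)"

end

theory Submission imports Defs "HOL-Combinatorics.Permutations" begin

text \<open>
  For a threshold \<open>K = \<Theta>(k log n)\<close> let \<open>d\<close> be the gcd of \<open>n\<close> and of all shifts \<open>g\<close> such that
  \<open>S\<close> differs from its rotation by \<open>g\<close> in at most \<open>K\<close> positions. At most \<open>log n\<close> of these shifts
  generate \<open>d\<close>, so the residue classes modulo \<open>d\<close> on which \<open>S\<close> is not constant can be written down
  completely using \<open>O(K log n)\<close> letters; what remains of \<open>S\<close> is a string of length \<open>d\<close>. A small Hamming
  distance changes the admissible thresholds by at most \<open>2k\<close>, and the divisor \<open>d\<close> can drop only
  \<open>log n\<close> times, so on one of \<open>2 log n\<close> equally spaced thresholds both strings have the same \<open>d\<close>.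

  It remains to align the two strings modulo \<open>d\<close>. Read at random offsets, about \<open>n / 8k\<close> letters form a
  context of a position. A context is likely to survive \<open>k\<close> mismatches, whereas two positions
  that differ modulo \<open>d\<close> have different contexts, because the corresponding rotations differ in
  more than \<open>K\<close> positions. The position whose context comes first in a random order of all
  contexts is therefore, with constant probability, the same in both strings up to the rotation.
  Each string is sketched linearly, relative to this anchor, with random weights modulo an odd
  number; by a union bound over all sets of at most \<open>k\<close> mismatches the difference of two sketches
  determines the set of mismatches or shows that it is larger than \<open>k\<close>.
\<close>

section \<open>Rotations and near-periods\<close>

definition periodic :: "int \<Rightarrow> (int \<Rightarrow> 'a) \<Rightarrow> bool" where
  "periodic n f \<longleftrightarrow> (\<forall>x. f (x + n) = f x)"

definition shift_by :: "int \<Rightarrow> (int \<Rightarrow> 'a) \<Rightarrow> int \<Rightarrow> 'a" where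
  "shift_by m f x = f (x + m)"

definition cyc_ham :: "int \<Rightarrow> (int \<Rightarrow> 'a) \<Rightarrow> (int \<Rightarrow> 'a) \<Rightarrow> nat" where
  "cyc_ham n f g = card {x \<in> {0..<n}. f x \<noteq> g x}"

text \<open>Reading a string as a function on all integers with period n turns rotation into
  translation of the argument, so that indices need no reduction.\<close>

definition cyc_fun :: "'a list \<Rightarrow> int \<Rightarrow> 'a" where
  "cyc_fun S x = S ! nat (x mod int (length S))"

lemma periodic_add_mult:
  assumes "periodic n f"
  shows "f (x + n * h) = f x"
proof (induction h rule: int_induct[where k = 0])
  case (step1 i)
  have "f (x + n * (i + 1)) = f ((x + n * i) + n)" by (simp add: algebra_simps)
  then show ?case using step1 assms by (simp add: periodic_def)
next
  case (step2 i)
  have "f ((x + n * (i - 1)) + n) = f (x + n * i)" by (simp add: algebra_simps)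
  then show ?case using step2 assms by (simp add: periodic_def)
qed simp

lemma periodic_cong:
  assumes "periodic d f" "d dvd x - y"
  shows "f x = f y"
proof -
  obtain h where "x - y = d * h" using assms(2) by (auto elim: dvdE)
  then have "x = y + d * h" by simp
  then show ?thesis using periodic_add_mult[OF assms(1)] by simp
qed

lemma periodic_mod: "periodic n f \<Longrightarrow> f (x mod n) = f x"
  by (rule periodic_cong) (auto simp: mod_eq_dvd_iff[symmetric])

lemma periodic_shift: "periodic n f \<Longrightarrow> periodic n (shift_by m f)"
  by (simp add: periodic_def shift_by_def) (metis add.assoc add.commute)

text \<open>Translation by m followed by reduction modulo n permutes the window {0..<n}; translation
  by -m undoes it.\<close>

lemma card_periodic_shift:
  assumes "periodic n P" "n > 0"
  shows "card {x \<in> {0..<n}. P (x + m)} = card {x \<in> {0..<n}. P x}"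
proof (rule bij_betw_same_card)
  show "bij_betw (\<lambda>x. (x + m) mod n) {x \<in> {0..<n}. P (x + m)} {x \<in> {0..<n}. P x}"
  proof (rule bij_betw_byWitness[where f' = "\<lambda>x. (x - m) mod n"])
    show "\<forall>x\<in>{x \<in> {0..<n}. P (x + m)}. ((x + m) mod n - m) mod n = x"
      by (auto simp: mod_diff_left_eq)
    show "\<forall>x\<in>{x \<in> {0..<n}. P x}. ((x - m) mod n + m) mod n = x"
      by (auto simp: mod_add_left_eq)
    show "(\<lambda>x. (x + m) mod n) ` {x \<in> {0..<n}. P (x + m)} \<subseteq> {x \<in> {0..<n}. P x}"
      using assms periodic_mod[OF assms(1)] by auto
    have "P ((x - m) mod n + m) = P x" for x
      by (rule periodic_cong[OF assms(1)]) (simp add: mod_eq_dvd_iff[symmetric] mod_add_left_eq)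
    then show "(\<lambda>x. (x - m) mod n) ` {x \<in> {0..<n}. P x} \<subseteq> {x \<in> {0..<n}. P (x + m)}"
      using assms(2) by auto
  qed
qed

lemma cyc_ham_shift:
  assumes "periodic n f" "periodic n g" "n > 0"
  shows "cyc_ham n (shift_by m f) (shift_by m g) = cyc_ham n f g"
  unfolding cyc_ham_def shift_by_def
  by (rule card_periodic_shift[where P = "\<lambda>x. f x \<noteq> g x"])
     (use assms in \<open>auto simp: periodic_def\<close>)

lemma cyc_ham_commute: "cyc_ham n f g = cyc_ham n g f"
  unfolding cyc_ham_def by (rule arg_cong[where f = card]) auto

lemma cyc_ham_triangle: "cyc_ham n f h \<le> cyc_ham n f g + cyc_ham n g h"
proof -
  have "cyc_ham n f h \<le> card ({x \<in> {0..<n}. f x \<noteq> g x} \<union> {x \<in> {0..<n}. g x \<noteq> h x})"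
    unfolding cyc_ham_def by (intro card_mono finite_UnI finite_Collect_conjI) auto
  also have "\<dots> \<le> cyc_ham n f g + cyc_ham n g h"
    unfolding cyc_ham_def by (rule card_Un_le)
  finally show ?thesis .
qed

lemma cyc_ham_le: "n \<ge> 0 \<Longrightarrow> int (cyc_ham n f g) \<le> n"
proof -
  assume "n \<ge> 0"
  have "cyc_ham n f g \<le> card {0..<n}"
    unfolding cyc_ham_def by (rule card_mono) auto
  then show ?thesis using \<open>n \<ge> 0\<close> by simp
qed

lemma shift_shift: "shift_by a (shift_by b f) = shift_by (a + b) f"
  by (simp add: shift_by_def fun_eq_iff algebra_simps)

section \<open>Strings as periodic functions\<close>

lemma periodic_cyc_fun: "periodic (int (length S)) (cyc_fun S)"
  by (simp add: periodic_def cyc_fun_def)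

lemma cyc_fun_in_set: "S \<noteq> [] \<Longrightarrow> cyc_fun S x \<in> set S"
  unfolding cyc_fun_def by (rule nth_mem) (simp add: nat_less_iff)

lemma length_inv_rotate1_pow: "length ((inv rotate1 ^^ k) S) = length S"
proof -
  have "length (inv rotate1 T) = length T" for T :: "'a list"
    by (metis length_rotate1 surj_rotate1 surj_f_inv_f)
  then show ?thesis by (induction k) auto
qed

lemma length_cyc_pow [simp]: "length (cyc_pow m S) = length S"
  by (simp add: cyc_pow_def length_inv_rotate1_pow flip: rotate_def)

lemma rotate_inv_rotate1_pow: "rotate k ((inv rotate1 ^^ k) S) = S"
proof -
  have "(rotate1 ^^ k) ((inv rotate1 ^^ k) S) = S"
  proof (induction k arbitrary: S)
    case (Suc k)
    have "(rotate1 ^^ Suc k) ((inv rotate1 ^^ Suc k) S)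
        = (rotate1 ^^ k) (rotate1 (inv rotate1 ((inv rotate1 ^^ k) S)))"
      by (subst funpow_Suc_right) simp
    then show ?case using Suc by (simp add: surj_f_inv_f[OF surj_rotate1])
  qed simp
  then show ?thesis by (simp add: rotate_def)
qed

lemma cyc_fun_rotate:
  assumes "S \<noteq> []"
  shows "cyc_fun (rotate k S) x = cyc_fun S (x + int k)"
proof -
  let ?n = "int (length S)"
  have n: "?n > 0" using assms by simp
  have "rotate k S ! nat (x mod ?n) = S ! ((k + nat (x mod ?n)) mod length S)"
    by (rule nth_rotate) (use n in \<open>simp add: nat_less_iff\<close>)
  moreover have "(k + nat (x mod ?n)) mod length S = nat ((x + int k) mod ?n)"
  proof -
    have "int ((k + nat (x mod ?n)) mod length S) = (x + int k) mod ?n"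
      using n by (simp add: zmod_int mod_add_right_eq add.commute)
    then show ?thesis by linarith
  qed
  ultimately show ?thesis by (simp add: cyc_fun_def)
qed

lemma cyc_fun_cyc_pow:
  assumes "S \<noteq> []"
  shows "cyc_fun (cyc_pow m S) = shift_by m (cyc_fun S)"
proof (cases "0 \<le> m")
  case True
  then show ?thesis
    using assms by (simp add: cyc_pow_def fun_eq_iff shift_by_def cyc_fun_rotate flip: rotate_def)
next
  case False
  define k where "k = nat (- m)"
  define T where "T = (inv rotate1 ^^ k) S"
  have "T \<noteq> []" using assms length_inv_rotate1_pow[of k S] by (auto simp: T_def)
  \<comment> \<open>The inverse rotation is not computed: S is \<open>rotate k T\<close> with k =
    -m, and the rule for forward rotations is read at x + m.\<close>
  then have "cyc_fun S (x + m) = cyc_fun T x" for x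
    using cyc_fun_rotate[of T k "x + m"] rotate_inv_rotate1_pow[of k S] False
    by (simp add: T_def k_def)
  moreover have "cyc_pow m S = T" using False by (simp add: cyc_pow_def T_def k_def)
  ultimately show ?thesis by (simp add: fun_eq_iff shift_by_def)
qed

lemma Ham_eq_cyc_ham:
  assumes "length S = n" "length T = n"
  shows "Ham S T = cyc_ham (int n) (cyc_fun S) (cyc_fun T)"
proof -
  have "bij_betw int {i. i < length S \<and> S ! i \<noteq> T ! i} {x \<in> {0..<int n}. cyc_fun S x \<noteq> cyc_fun T x}"
    by (rule bij_betw_byWitness[where f' = nat]) (use assms in \<open>auto simp: cyc_fun_def nat_less_iff\<close>)
  then show ?thesis unfolding Ham_def cyc_ham_def by (rule bij_betw_same_card)
qed

lemma Ham_cyc_pow: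
  assumes "length S = n" "length T = n" "n > 0"
  shows "Ham S (cyc_pow m T) = cyc_ham (int n) (cyc_fun S) (shift_by m (cyc_fun T))"
  using Ham_eq_cyc_ham[of S n "cyc_pow m T"] assms cyc_fun_cyc_pow[of T m] by fastforce

section \<open>Near-periods and their gcd\<close>

definition near_periods :: "int \<Rightarrow> nat \<Rightarrow> (int \<Rightarrow> 'a) \<Rightarrow> int set" where
  "near_periods n K s = {m \<in> {0..<n}. cyc_ham n s (shift_by m s) \<le> K}"

text \<open>Inserting n keeps the gcd a positive divisor of n even when 0 is the only near-period.
  Raising K adds near-periods, so the gcd can only move down in the divisibility order.\<close>

definition near_gcd :: "int \<Rightarrow> nat \<Rightarrow> (int \<Rightarrow> 'a) \<Rightarrow> int" where
  "near_gcd n K s = Gcd (insert n (near_periods n K s))"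

lemma near_gcd_dvd: "near_gcd n K s dvd n"
  by (simp add: near_gcd_def)

lemma near_gcd_pos: "n > 0 \<Longrightarrow> near_gcd n K s > 0"
  unfolding near_gcd_def by (simp add: gcd_pos_int)

text \<open>Two close rotations differ by a near-period. The contrapositive is what makes contexts
  distinguish residue classes: offsets that are incongruent modulo the gcd give rotations more than
  K apart.\<close>

lemma near_gcd_dvd_diff:
  assumes "periodic n s" "n > 0" "cyc_ham n (shift_by x s) (shift_by y s) \<le> K"
  shows "near_gcd n K s dvd y - x"
proof -
  have "shift_by y s = shift_by x (shift_by (y - x) s)" by (simp add: shift_shift)
  then have "cyc_ham n s (shift_by (y - x) s) \<le> K"
    using cyc_ham_shift[OF assms(1) periodic_shift[OF assms(1)] assms(2), of x "y - x"] assms(3) by simp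
  moreover have "shift_by (y - x) s = shift_by ((y - x) mod n) s"
    by (rule ext, unfold shift_by_def, rule periodic_cong[OF assms(1)])
       (simp add: dvd_minus_mod)
  ultimately have "(y - x) mod n \<in> near_periods n K s"
    using assms(2) by (simp add: near_periods_def)
  then have "near_gcd n K s dvd (y - x) mod n"
    unfolding near_gcd_def by (intro Gcd_dvd) simp
  with near_gcd_dvd[of n K s] show ?thesis by (simp add: dvd_mod_iff)
qed

text \<open>Going from s' over to s, along a near-period g of s, and back to s' costs at most k + K
  + k mismatches. So every near-period of s at threshold K is one of s' at threshold K'.\<close>

lemma near_gcd_dvd_near_gcd:
  assumes "periodic n s" "periodic n s'" "n > 0" "cyc_ham n s (shift_by m s') \<le> k"
    and "K + 2 * k \<le> K'"
  shows "near_gcd n K' s' dvd near_gcd n K s"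
proof -
  have "near_periods n K s \<subseteq> near_periods n K' s'"
  proof
    fix g assume g: "g \<in> near_periods n K s"
    have "cyc_ham n (shift_by m s') (shift_by m (shift_by g s')) = cyc_ham n s' (shift_by g s')"
      by (intro cyc_ham_shift periodic_shift assms)
    moreover have "cyc_ham n (shift_by m s') (shift_by m (shift_by g s')) 
        \<le> cyc_ham n (shift_by m s') s + (cyc_ham n s (shift_by g s) + cyc_ham n (shift_by g s) (shift_by m (shift_by g s')))"
      by (meson add_left_mono cyc_ham_triangle order_trans)
    moreover have "cyc_ham n (shift_by g s) (shift_by m (shift_by g s')) = cyc_ham n s (shift_by m s')"
      using cyc_ham_shift[OF assms(1) periodic_shift[OF assms(2)] assms(3), of g m]
      by (simp add: shift_shift add.commute)
    ultimately have "cyc_ham n s' (shift_by g s') \<le> k + (K + k)"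
      using g assms(4) by (simp add: near_periods_def cyc_ham_commute[of n "shift_by m s'" s])
    then show "g \<in> near_periods n K' s'" using g assms(5) by (simp add: near_periods_def)
  qed
  then show ?thesis unfolding near_gcd_def 
    by (intro Gcd_greatest Gcd_dvd) auto
qed

text \<open>Each proper drop at least halves the value, so l proper drops in a row would give 2 ^ l
  * c l <= c 0.\<close>

lemma dvd_chain_stabilizes:
  fixes c :: "nat \<Rightarrow> int"
  assumes "\<And>i. c (Suc i) dvd c i" "\<And>i. c i > 0" "c 0 < 2 ^ l"
  shows "\<exists>i<l. c (Suc i) = c i"
proof (rule ccontr)
  assume H: "\<not> ?thesis"
  have "2 ^ i * c i \<le> c 0" if "i \<le> l" for i
    using that
  proof (induction i)
    case (Suc i)
    obtain h where h: "c i = c (Suc i) * h" using assms(1) by (auto elim: dvdE)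
    have "h > 0" using h assms(2)[of i] assms(2)[of "Suc i"] by (simp add: zero_less_mult_iff)
    moreover have "h \<noteq> 1" using h H Suc.prems by (auto simp: Suc_le_eq)
    ultimately have "2 \<le> h" by linarith
    then have "c (Suc i) * 2 \<le> c i" unfolding h using assms(2)[of "Suc i"] by simp
    then have "2 ^ i * (c (Suc i) * 2) \<le> 2 ^ i * c i" by (rule mult_left_mono) simp
    moreover have "2 ^ Suc i * c (Suc i) = 2 ^ i * (c (Suc i) * 2)" by simp
    ultimately show ?case using Suc by linarith
  qed simp
  from this[of l] have "2 ^ l * c l \<le> c 0" by simp
  moreover have "2 ^ l * 1 \<le> 2 ^ l * c l" using assms(2)[of l] by (intro mult_left_mono) auto
  ultimately show False using assms(3) by simp
qed

text \<open>Thresholds 2k apart interlace two chains of divisors: the gcd of either string at level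
  j + 1 divides that of the other at level j. If the first chain is constant from level 2i to level
  2i + 2, the second chain is squeezed to the same value at level 2i + 1.\<close>

lemma common_near_gcd_level:
  assumes "periodic n s" "periodic n s'" "n > 0" "n < 2 ^ l" "cyc_ham n s (shift_by m s') \<le> k"
  shows "\<exists>j<2*l. near_gcd n (K0 + 2 * k * j) s = near_gcd n (K0 + 2 * k * j) s'"
proof -
  define D where "D j = near_gcd n (K0 + 2 * k * j) s" for j
  define D' where "D' j = near_gcd n (K0 + 2 * k * j) s'" for j
  have "cyc_ham n s' (shift_by (- m) s) = cyc_ham n (shift_by (-m) (shift_by m s')) (shift_by (- m) s)"
    by (simp add: shift_shift) (simp add: shift_by_def[abs_def])
  also have "\<dots> = cyc_ham n s (shift_by m s')"
    by (subst cyc_ham_shift) (use assms periodic_shift cyc_ham_commute in auto)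
  finally have h': "cyc_ham n s' (shift_by (- m) s) \<le> k" using assms(5) by simp
  have h0: "cyc_ham n s (shift_by 0 s) \<le> 0" by (simp add: cyc_ham_def shift_by_def)
  have 1: "D' (Suc j) dvd D j" for j unfolding D_def D'_def
    by (rule near_gcd_dvd_near_gcd[OF assms(1,2,3,5)]) simp
  have 2: "D (Suc j) dvd D' j" for j unfolding D_def D'_def
    by (rule near_gcd_dvd_near_gcd[OF assms(2,1,3) h']) simp
  \<comment> \<open>Monotonicity in the threshold is the case of a string compared with itself, at
    distance 0.\<close>
  have 3: "D (Suc j) dvd D j" for j unfolding D_def
    by (rule near_gcd_dvd_near_gcd[OF assms(1,1,3) h0]) simp
  have pos: "D j > 0" "D' j > 0" for j unfolding D_def D'_def using near_gcd_pos[OF assms(3)] by auto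
  have "D 0 \<le> n" unfolding D_def using near_gcd_dvd zdvd_imp_le assms(3) by blast
  \<comment> \<open>Only even levels are tested, which leaves an odd level strictly in between; this
    is why 2 * l levels serve for l possible drops.\<close>
  then obtain i where i: "i < l" "D (2 * Suc i) = D (2 * i)"
    using dvd_chain_stabilizes[of "\<lambda>i. D (2 * i)" l] 3 pos assms(4) by (auto intro: dvd_trans)
  have "D (Suc (2 * i)) = D (2 * i)"
    using 3[of "2*i"] 3[of "Suc (2*i)"] i(2) pos by (auto intro!: zdvd_antisym_nonneg less_imp_le)
  moreover have "D' (Suc (2 * i)) = D (2 * i)"
    using 1[of "2*i"] 2[of "Suc (2*i)"] i(2) pos by (auto intro!: zdvd_antisym_nonneg less_imp_le)
  ultimately show ?thesis using i(1) unfolding D_def D'_def by (intro exI[of _ "Suc (2*i)"]) simp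
qed

section \<open>Non-constant residue classes\<close>

text \<open>Greedy choice: an element g of G that is not a multiple of n replaces n by
  \<open>gcd n g\<close>, which is at most n / 2. Since n < 2 ^ l, at most l elements are
  chosen.\<close>

lemma exists_few_gcd_generators:
  fixes G :: "int set"
  assumes "n > 0" "n < 2 ^ l"
  shows "\<exists>F\<subseteq>G. finite F \<and> card F \<le> l \<and> Gcd (insert n F) = Gcd (insert n G)"
  using assms
proof (induction l arbitrary: n)
  case 0
  then show ?case by simp
next
  case (Suc l)
  show ?case
  proof (cases "\<forall>g\<in>G. n dvd g")
    case True
    then have "n dvd Gcd G" by (intro Gcd_greatest) auto
    then have "gcd n (Gcd G) = n" using Suc.prems by (simp add: gcd_proj1_iff)
    then show ?thesis using Suc.prems by (intro exI[of _ "{}"]) simp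
  next
    case False
    then obtain g where g: "g \<in> G" "\<not> n dvd g" by auto
    define n' where "n' = gcd n g"
    have n': "n' > 0" using Suc.prems by (simp add: n'_def)
    obtain h where h: "n = n' * h" unfolding n'_def using gcd_dvd1[of n g] unfolding dvd_def by blast
    have "h > 0" using h n' Suc.prems(1) by (simp add: zero_less_mult_iff)
    moreover have "h \<noteq> 1" 
    proof
      assume "h = 1"
      then have "n = n'" using h by simp
      then show False using g(2) gcd_dvd2[of n g] by (simp add: n'_def)
    qed
    ultimately have "2 \<le> h" by linarith
    then have "n' * 2 \<le> n" unfolding h using n' by simp
    then have "n' < 2 ^ l" using Suc.prems(2) by simp
    then obtain F where F: "F \<subseteq> G" "finite F" "card F \<le> l" "Gcd (insert n' F) = Gcd (insert n' G)"
      using Suc.IH[OF n'] by blast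
    have "Gcd (insert n (insert g F)) = Gcd (insert n' F)"
      by (simp add: n'_def gcd.assoc)
    moreover have "Gcd (insert n' G) = Gcd (insert n (insert g G))"
      by (simp add: n'_def gcd.assoc)
    moreover have "insert g G = G" using g(1) by auto
    ultimately show ?thesis using F g(1)
      by (intro exI[of _ "insert g F"]) (auto simp: card_insert_if)
  qed
qed

text \<open>By Bezout the gcd is an integer combination of the periods.\<close>

lemma periodic_Gcd:
  assumes "finite F" "periodic n f" "\<And>h. h \<in> F \<Longrightarrow> periodic h f"
  shows "periodic (Gcd (insert n F)) f"
  using assms(1,3)
proof (induction F rule: finite_induct)
  case empty
  \<comment> \<open>The gcd of {n} is the absolute value of n, so both signs have to be
    covered.\<close>
  have "periodic (- n) f" using periodic_add_mult[OF assms(2), of _ "-1"] by (simp add: periodic_def)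
  then show ?case using assms(2) by (simp add: abs_if)
next
  case (insert h F)
  define d where "d = Gcd (insert n F)"
  have d: "periodic d f" using insert by (simp add: d_def)
  have h: "periodic h f" using insert by simp
  obtain u v where uv: "u * h + v * d = gcd h d" using bezout_int by blast
  have "f (x + gcd h d) = f x" for x
  proof -
    have "f (x + gcd h d) = f ((x + h * u) + d * v)" by (simp add: uv[symmetric] algebra_simps)
    then show ?thesis using periodic_add_mult[OF d] periodic_add_mult[OF h] by simp
  qed
  moreover have "Gcd (insert n (insert h F)) = gcd h d" by (simp add: d_def gcd.left_commute)
  ultimately show ?case by (simp add: periodic_def)
qed

definition special :: "int \<Rightarrow> (int \<Rightarrow> 'a) \<Rightarrow> int \<Rightarrow> bool" where
  "special d s x \<longleftrightarrow> (\<exists>h. s (x + d * h) \<noteq> s x)"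

text \<open>Marking the other classes by \<open>None\<close> makes the special part remember which
  classes are non-constant, not only their letters.\<close>

definition special_part :: "int \<Rightarrow> (int \<Rightarrow> 'a) \<Rightarrow> int \<Rightarrow> 'a option" where
  "special_part d s x = (if special d s x then Some (s x) else None)"

text \<open>Masking the non-constant classes by one common symbol leaves a function that is truly
  periodic with period d, hence a string of length d.\<close>

definition regular_part :: "int \<Rightarrow> (int \<Rightarrow> 'a) \<Rightarrow> int \<Rightarrow> 'a option" where
  "regular_part d s x = (if special d s x then None else Some (s x))"

text \<open>A small certificate for the special part: each near-period in F contributes at most K
  breaks. Both letters are stored, so that two functions with the same breaks agree at both ends of
  each of them.\<close>

definition breaks :: "int \<Rightarrow> int set \<Rightarrow> (int \<Rightarrow> 'a) \<Rightarrow> (int \<times> int \<times> 'a \<times> 'a) set" where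
  "breaks n F s = (\<lambda>(h, x). (h, x, s x, s (x + h))) ` (SIGMA h:F. {x \<in> {0..<n}. s x \<noteq> s (x + h)})"

lemma special_cong:
  assumes "d dvd x - y"
  shows "special d s x \<longleftrightarrow> special d s y"
proof -
  have "special d s y" if dvd: "d dvd x - y" and sp: "special d s x" for x y
  proof (rule ccontr)
    assume "\<not> special d s y"
    then have c: "s (y + d * h) = s y" for h by (simp add: special_def)
    obtain g where "x - y = d * g" using dvd unfolding dvd_def by blast
    then have g: "x = y + d * g" by simp
    have "s (x + d * h) = s x" for h
      using c[of "g + h"] c[of g] by (simp add: g algebra_simps)
    then show False using sp by (simp add: special_def)
  qed
  then show ?thesis using assms dvd_diff_commute[of d x y] by blast
qed

lemma periodic_regular_part: "periodic d (regular_part d s)"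
  unfolding periodic_def
proof
  fix x
  have "special d s (x + d) \<longleftrightarrow> special d s x" by (rule special_cong) simp
  moreover have "s (x + d * 1) = s x" if "\<not> special d s x" using that unfolding special_def by blast
  ultimately show "regular_part d s (x + d) = regular_part d s x" by (simp add: regular_part_def)
qed

lemma card_breaks_le:
  assumes "finite F" "F \<subseteq> near_periods n K s"
  shows "card (breaks n F s) \<le> card F * K" "finite (breaks n F s)"
proof -
  have fin1: "finite {x \<in> {0..<n}. s x \<noteq> s (x + h)}" for h
    by (rule finite_subset[of _ "{0..<n}"]) auto
  then have fin: "finite (SIGMA h:F. {x \<in> {0..<n}. s x \<noteq> s (x + h)})"
    using assms(1) by (intro finite_SigmaI)
  then show "finite (breaks n F s)" by (simp add: breaks_def)
  have "card (breaks n F s) \<le> card (SIGMA h:F. {x \<in> {0..<n}. s x \<noteq> s (x + h)})"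
    unfolding breaks_def by (rule card_image_le[OF fin])
  also have "\<dots> = (\<Sum>h\<in>F. cyc_ham n s (shift_by h s))"
    using assms(1) fin1 unfolding cyc_ham_def shift_by_def by (intro card_SigmaI) auto
  also have "\<dots> \<le> (\<Sum>h\<in>F. K)"
    using assms(2) by (intro sum_mono) (auto simp: near_periods_def)
  finally show "card (breaks n F s) \<le> card F * K" by simp
qed

lemma breaks_eq_imp:
  assumes "periodic n s" "periodic n s'" "n > 0" "breaks n F s = breaks n F s'" "h \<in> F"
    and "s x \<noteq> s (x + h)"
  shows "s' x = s x" "s' (x + h) = s (x + h)"
proof -
  let ?x = "x mod n"
  have e: "s ?x = s x" "s' ?x = s' x" using assms(1,2) periodic_mod by auto
  have "n dvd ?x + h - (x + h)" by (simp add: mod_eq_dvd_iff[symmetric] mod_add_left_eq)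
  then have e': "s (?x + h) = s (x + h)" "s' (?x + h) = s' (x + h)"
    using assms(1,2) periodic_cong by blast+
  have "(h, ?x, s ?x, s (?x + h)) \<in> breaks n F s"
    using assms(3,5,6) e e' by (force simp: breaks_def)
  then have "(h, ?x, s ?x, s (?x + h)) \<in> breaks n F s'" using assms(4) by simp
  then have "s ?x = s' ?x \<and> s (?x + h) = s' (?x + h)" by (auto simp: breaks_def)
  then show "s' x = s x" "s' (x + h) = s (x + h)" using e e' by auto
qed

text \<open>Agreement of the two functions propagates along every step in \<open>F\<close>, and every non-constant
  residue class contains a break, where they agree.\<close>
lemma special_part_determined_by_breaks:
  assumes "periodic n s" "periodic n s'" "n > 0" "finite F" "d = Gcd (insert n F)"
    and "breaks n F s = breaks n F s'"
  shows "special_part d s = special_part d s'"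
proof -
  have agree: "s y = s' y" if s: "periodic n s" "periodic n s'" and B: "breaks n F s = breaks n F s'"
    and dvd: "d dvd y - x" and sp: "special d s x" for s s' :: "int \<Rightarrow> 'a" and x y
  proof -
    \<comment> \<open>The agreement predicate is periodic for every h in F: if one of the functions
      breaks on the step, equality of the breaks gives agreement at both ends; otherwise neither
      function changes.\<close>
    have "periodic d (\<lambda>y. s y = s' y)"
      unfolding \<open>d = _\<close>
    proof (rule periodic_Gcd[OF \<open>finite F\<close>])
      show "periodic n (\<lambda>y. s y = s' y)" using s by (simp add: periodic_def)
      show "periodic h (\<lambda>y. s y = s' y)" if "h \<in> F" for h
        unfolding periodic_def
      proof
        fix y
        consider "s y \<noteq> s (y + h)" | "s' y \<noteq> s' (y + h)" | "s y = s (y + h)" "s' y = s' (y + h)" by blast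
        then show "(s (y + h) = s' (y + h)) = (s y = s' y)"
        proof cases
          case 1
          then show ?thesis using breaks_eq_imp[OF s \<open>n > 0\<close> B that 1] by simp
        next
          case 2
          then show ?thesis using breaks_eq_imp[OF s(2,1) \<open>n > 0\<close> B[symmetric] that 2] by simp
        qed simp
      qed
    qed
    note per = periodic_cong[OF this]
    \<comment> \<open>If s and s' disagreed throughout the class of x, the class would contain no
      break and s would be constant on it.\<close>
    have "\<exists>z. d dvd z - x \<and> s z = s' z"
    proof (rule ccontr)
      assume no: "\<not> ?thesis"
      \<comment> \<open>Restricting s to the class of x, with \<open>None\<close> elsewhere, turns a
        claim about one class into periodicity on all integers, to which \<open>periodic_Gcd\<close>
        applies.\<close>
      define f where "f z = (if d dvd z - x then Some (s z) else None)" for z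
      have dF: "d dvd h" if "h \<in> insert n F" for h using that unfolding \<open>d = _\<close> by (rule Gcd_dvd)
      have step: "periodic h f" if h: "h \<in> insert n F" and eq: "\<And>z. d dvd z - x \<Longrightarrow> s (z + h) = s z" for h
      proof -
        have "d dvd z + h - x \<longleftrightarrow> d dvd z - x" for z
          using dvd_add_left_iff[OF dF[OF h], of "z - x"] by (simp add: algebra_simps)
        then show ?thesis using eq unfolding periodic_def f_def by presburger
      qed
      have "periodic d f"
        unfolding \<open>d = Gcd (insert n F)\<close>
      proof (rule periodic_Gcd[OF \<open>finite F\<close>])
        have "s (z + n) = s z" for z using s(1) by (simp add: periodic_def)
        then show "periodic n f" by (rule step[OF insertI1])
        show "periodic h f" if "h \<in> F" for h
        proof (rule step)
          show "s (z + h) = s z" if z: "d dvd z - x" for z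
          proof (rule ccontr)
            assume "s (z + h) \<noteq> s z"
            then have "s' z = s z" using breaks_eq_imp(1)[OF s \<open>n > 0\<close> B \<open>h \<in> F\<close>, of z] by simp
            then show False using no z by auto
          qed
        qed (use that in simp)
      qed
      then have "f (x + d * g) = f x" for g by (rule periodic_add_mult)
      then have "s (x + d * g) = s x" for g by (simp add: f_def)
      then show False using sp by (simp add: special_def)
    qed
    then obtain z where z: "d dvd z - x" "s z = s' z" by auto
    have "d dvd y - z" using dvd_diff[OF dvd z(1)] by simp
    then show ?thesis using per z(2) by simp
  qed
  have *: "special d s' x \<and> s' x = s x" if "periodic n s" "periodic n s'" "breaks n F s = breaks n F s'"
    and sp: "special d s x" for s s' :: "int \<Rightarrow> 'a" and x
  proof -
    note a = agree[OF that(1,2,3) _ sp]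
    obtain h where h: "s (x + d * h) \<noteq> s x" using sp unfolding special_def by blast
    have e: "s (x + d * h) = s' (x + d * h)" "s x = s' x" using a[of "x + d * h"] a[of x] by simp_all
    then have "s' (x + d * h) \<noteq> s' x" using h by simp
    then show ?thesis using e(2) unfolding special_def by metis
  qed
  show ?thesis
  proof
    fix x
    show "special_part d s x = special_part d s' x"
    proof (cases "special d s x")
      case True
      then show ?thesis using *[OF assms(1,2,6) True] by (simp add: special_part_def)
    next
      case False
      then have "\<not> special d s' x" using *[OF assms(2,1) assms(6)[symmetric], of x] by blast
      then show ?thesis using False by (simp add: special_part_def)
    qed
  qed
qed

section \<open>Counting the possible special parts\<close>

lemma finite_bounded_subsets: "finite U \<Longrightarrow> finite {X. X \<subseteq> U \<and> card X \<le> b}"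
  by (rule finite_subset[of _ "Pow U"]) auto

text \<open>A set of at most b + 1 elements arises from one of at most b elements by inserting one
  element of U or nothing; the option type supplies the extra 1 in the base.\<close>

lemma card_bounded_subsets:
  assumes "finite U"
  shows "card {X. X \<subseteq> U \<and> card X \<le> b} \<le> (card U + 1) ^ b"
proof (induction b)
  case 0
  have "{X. X \<subseteq> U \<and> card X \<le> 0} = {{}}" 
    by (auto simp: card_eq_0_iff dest: finite_subset[OF _ assms])
  then show ?case by simp
next
  case (Suc b)
  let ?S = "\<lambda>b. {X. X \<subseteq> U \<and> card X \<le> b}"
  let ?f = "\<lambda>(u, X). case u of None \<Rightarrow> X | Some u \<Rightarrow> insert u X"
  let ?O = "insert None (Some ` U)"
  have "?S (Suc b) \<subseteq> ?f ` (?O \<times> ?S b)"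
  proof
    fix X assume X: "X \<in> ?S (Suc b)"
    show "X \<in> ?f ` (?O \<times> ?S b)"
    proof (cases "X = {}")
      case True
      then show ?thesis by (intro image_eqI[of _ _ "(None, {})"]) auto
    next
      case False
      then obtain u where u: "u \<in> X" by auto
      have "finite X" using X finite_subset[OF _ assms] by auto
      then have "card (X - {u}) \<le> b" using X u by (auto simp: card_Diff_singleton)
      then show ?thesis using X u by (intro image_eqI[of _ _ "(Some u, X - {u})"]) auto
    qed
  qed
  then have "card (?S (Suc b)) \<le> card (?f ` (?O \<times> ?S b))"
    using assms finite_bounded_subsets by (intro card_mono) auto
  also have "\<dots> \<le> card (?O \<times> ?S b)"
    using assms finite_bounded_subsets by (intro card_image_le) auto
  also have "\<dots> = (card U + 1) * card (?S b)"
    using assms by (simp add: card_cartesian_product card_image)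
  also have "\<dots> \<le> (card U + 1) * (card U + 1) ^ b" by (intro mult_left_mono Suc) simp
  finally show ?case by simp
qed

text \<open>On P the function g factors through f.\<close>

lemma card_image_le_if_determined:
  assumes "finite (f ` P)" "\<And>x y. x \<in> P \<Longrightarrow> y \<in> P \<Longrightarrow> f x = f y \<Longrightarrow> g x = g y"
  shows "card (g ` P) \<le> card (f ` P)" "finite (g ` P)"
proof -
  have "g ` P = (\<lambda>z. g (inv_into P f z)) ` f ` P"
  proof -
    have "g (inv_into P f (f x)) = g x" if "x \<in> P" for x
    proof (rule assms(2))
      show "inv_into P f (f x) \<in> P" using that by (intro inv_into_into) simp
      show "f (inv_into P f (f x)) = f x" using that by (intro f_inv_into_f) simp
    qed (rule that)
    then show ?thesis by (simp add: image_image)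
  qed
  then show "card (g ` P) \<le> card (f ` P)" "finite (g ` P)"
    using assms(1) card_image_le[of "f ` P"] by simp_all
qed

text \<open>Each s is encoded by at most l near-periods that generate its gcd, together with the at
  most l * K breaks along them. The two factors count these two sets, and the pair determines the
  gcd and the special part.\<close>

lemma card_special_parts:
  fixes P :: "(int \<Rightarrow> 'a) set" and n :: nat
  assumes "\<And>s. s \<in> P \<Longrightarrow> periodic (int n) s" "\<And>s x. s \<in> P \<Longrightarrow> s x \<in> A" "finite A"
    and "n > 0" "n < 2 ^ l"
  shows "card ((\<lambda>s. (near_gcd n K s, special_part (near_gcd n K s) s)) ` P)
           \<le> (n + 1) ^ l * (n * n * card A * card A + 1) ^ (l * K)" (is "card (?g ` P) \<le> _")
    and "finite ((\<lambda>s. (near_gcd n K s, special_part (near_gcd n K s) s)) ` P)"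
proof -
  define good where "good s F \<longleftrightarrow> F \<subseteq> near_periods n K s \<and> finite F \<and> card F \<le> l
    \<and> Gcd (insert (int n) F) = Gcd (insert (int n) (near_periods n K s))" for s :: "int \<Rightarrow> 'a" and F
  define F where "F s = (SOME F. good s F)" for s
  have "int n > 0" "int n < 2 ^ l" using assms(4,5) by simp_all
  then have "\<exists>F. good s F" for s
    unfolding good_def by (rule exists_few_gcd_generators)
  then have "good s (F s)" for s unfolding F_def by (rule someI_ex)
  then have F: "F s \<subseteq> near_periods n K s" "finite (F s)" "card (F s) \<le> l"
    "near_gcd n K s = Gcd (insert (int n) (F s))" for s
    unfolding good_def near_gcd_def by simp_all
  define f where "f s = (F s, breaks n (F s) s)" for s
  define I where "I = {0..<int n}"
  let ?U1 = "{X. X \<subseteq> I \<and> card X \<le> l}" and ?U2 = "{X. X \<subseteq> I \<times> I \<times> A \<times> A \<and> card X \<le> l * K}"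
  have sub: "f ` P \<subseteq> ?U1 \<times> ?U2"
  proof
    fix z assume "z \<in> f ` P"
    then obtain s where s: "s \<in> P" "z = f s" by auto
    have FI: "F s \<subseteq> I" using F(1)[of s] by (auto simp: I_def near_periods_def)
    have "card (breaks n (F s) s) \<le> card (F s) * K" by (rule card_breaks_le[OF F(2,1)])
    also have "\<dots> \<le> l * K" using F(3) by simp
    finally have "card (breaks n (F s) s) \<le> l * K" .
    moreover have "breaks n (F s) s \<subseteq> I \<times> I \<times> A \<times> A"
      using FI assms(2)[OF s(1)] by (auto simp: breaks_def I_def)
    ultimately show "z \<in> ?U1 \<times> ?U2" using s F(3) FI by (auto simp: f_def)
  qed
  have fin: "finite I" "finite (I \<times> I \<times> A \<times> A)" using assms(3) by (auto simp: I_def)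
  have finU: "finite (?U1 \<times> ?U2)"
    by (intro finite_cartesian_product finite_bounded_subsets fin)
  have finf: "finite (f ` P)" by (rule finite_subset[OF sub finU])
  have det: "?g s = ?g s'" if "s \<in> P" "s' \<in> P" "f s = f s'" for s s'
  proof -
    have eq: "near_gcd n K s = near_gcd n K s'" using F(4) that(3) by (simp add: f_def)
    moreover have "special_part (near_gcd n K s) s = special_part (near_gcd n K s) s'"
    proof (rule special_part_determined_by_breaks[OF _ _ _ F(2)[of s] F(4)])
      show "periodic (int n) s" "periodic (int n) s'" using that assms(1) by auto
      show "breaks (int n) (F s) s = breaks (int n) (F s) s'" using that(3) by (auto simp: f_def)
    qed (use assms(4) in simp)
    ultimately show ?thesis by simp
  qed
  show "finite (?g ` P)" using card_image_le_if_determined(2)[OF finf det] .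
  have "card (?g ` P) \<le> card (f ` P)" using card_image_le_if_determined(1)[OF finf det] .
  also have "\<dots> \<le> card (?U1 \<times> ?U2)" by (rule card_mono[OF finU sub])
  also have "\<dots> \<le> (card I + 1) ^ l * (card (I \<times> I \<times> A \<times> A) + 1) ^ (l * K)"
    unfolding card_cartesian_product[of ?U1] by (intro mult_mono card_bounded_subsets fin) auto
  also have "\<dots> = (n + 1) ^ l * (n * n * card A * card A + 1) ^ (l * K)"
    by (simp add: card_cartesian_product I_def mult.assoc)
  finally show "card (?g ` P) \<le> (n + 1) ^ l * (n * n * card A * card A + 1) ^ (l * K)" .
qed

section \<open>Linear sketches of mismatches\<close>

text \<open>The letters are recorded along with the position. They matter at mixed positions,
  special in one string and regular in the other, where a regular letter has to be compared with a
  special one.\<close>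

definition mismatches ::
  "int \<Rightarrow> int \<Rightarrow> int \<Rightarrow> (int \<Rightarrow> 'b) \<Rightarrow> (int \<Rightarrow> 'b) \<Rightarrow> (int \<times> 'b \<times> 'b) set" where
  "mismatches d a\<^sub>1 a\<^sub>2 T\<^sub>1 T\<^sub>2 =
     (\<lambda>x. (x, T\<^sub>1 (x + a\<^sub>1), T\<^sub>2 (x + a\<^sub>2))) ` {x \<in> {0..<d}. T\<^sub>1 (x + a\<^sub>1) \<noteq> T\<^sub>2 (x + a\<^sub>2)}"

lemma mismatches_iff:
  "(x, u, v) \<in> mismatches d a\<^sub>1 a\<^sub>2 T\<^sub>1 T\<^sub>2 \<longleftrightarrow>
     0 \<le> x \<and> x < d \<and> u = T\<^sub>1 (x + a\<^sub>1) \<and> v = T\<^sub>2 (x + a\<^sub>2) \<and> u \<noteq> v"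
  by (auto simp: mismatches_def)

text \<open>At the class of x either the regular parts coincide in both pairs, or both regular
  symbols are recorded and therefore the same in the two pairs. The special parts supply the masked
  letters.\<close>

lemma mismatches_determine_mismatch:
  assumes d: "d > 0" "d dvd a\<^sub>2 - a\<^sub>1 - m"
    and sp: "special_part d s\<^sub>1 = special_part d s\<^sub>1'" "special_part d s\<^sub>2 = special_part d s\<^sub>2'"
    and W: "mismatches d a\<^sub>1 a\<^sub>2 (regular_part d s\<^sub>1) (regular_part d s\<^sub>2)
          = mismatches d a\<^sub>1 a\<^sub>2 (regular_part d s\<^sub>1') (regular_part d s\<^sub>2')"
  shows "s\<^sub>1 x = s\<^sub>2 (x + m) \<longleftrightarrow> s\<^sub>1' x = s\<^sub>2' (x + m)"
proof -
  define z where "z = (x - a\<^sub>1) mod d"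
  have z: "0 \<le> z" "z < d" using d(1) by (auto simp: z_def)
  have "d dvd z - (x - a\<^sub>1)" by (simp add: z_def mod_eq_dvd_iff[symmetric])
  then have 1: "d dvd (z + a\<^sub>1) - x" by (simp add: algebra_simps)
  then have "d dvd ((z + a\<^sub>1) - x) + (a\<^sub>2 - a\<^sub>1 - m)" using d(2) by (rule dvd_add)
  then have 2: "d dvd (z + a\<^sub>2) - (x + m)" by (simp add: algebra_simps)
  note r = periodic_cong[OF periodic_regular_part 1] periodic_cong[OF periodic_regular_part 2]
  have iff: "(z, u, v) \<in> mismatches d a\<^sub>1 a\<^sub>2 (regular_part d t\<^sub>1) (regular_part d t\<^sub>2) \<longleftrightarrow>
      u = regular_part d t\<^sub>1 x \<and> v = regular_part d t\<^sub>2 (x + m) \<and> u \<noteq> v" for t\<^sub>1 t\<^sub>2 u v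
    unfolding mismatches_iff r using z by simp
  have reg: "regular_part d s\<^sub>1 x = regular_part d s\<^sub>2 (x + m) \<and>
        regular_part d s\<^sub>1' x = regular_part d s\<^sub>2' (x + m) \<or>
      regular_part d s\<^sub>1 x = regular_part d s\<^sub>1' x \<and>
        regular_part d s\<^sub>2 (x + m) = regular_part d s\<^sub>2' (x + m)"
    using iff[of "regular_part d s\<^sub>1 x" "regular_part d s\<^sub>2 (x + m)" s\<^sub>1 s\<^sub>2]
      iff[of "regular_part d s\<^sub>1 x" "regular_part d s\<^sub>2 (x + m)" s\<^sub>1' s\<^sub>2']
      iff[of "regular_part d s\<^sub>1' x" "regular_part d s\<^sub>2' (x + m)" s\<^sub>1 s\<^sub>2]
      iff[of "regular_part d s\<^sub>1' x" "regular_part d s\<^sub>2' (x + m)" s\<^sub>1' s\<^sub>2']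
    unfolding W by argo
  have "special_part d s\<^sub>1 x = special_part d s\<^sub>1' x"
    "special_part d s\<^sub>2 (x + m) = special_part d s\<^sub>2' (x + m)" using sp by simp_all
  with reg show ?thesis
    unfolding special_part_def regular_part_def
    by (cases "special d s\<^sub>1 x"; cases "special d s\<^sub>2 (x + m)"; 
        cases "special d s\<^sub>1' x"; cases "special d s\<^sub>2' (x + m)") auto
qed

text \<open>A mismatch of regular parts needs a genuine mismatch somewhere in its residue class,
  because strings that agree on a whole class also agree on whether it is constant. Different
  classes give different positions.\<close>

lemma card_mismatches_le:
  assumes "periodic n s\<^sub>1" "periodic n s\<^sub>2" "n > 0" "d > 0" "d dvd n" "d dvd a\<^sub>2 - a\<^sub>1 - m"
  shows "card (mismatches d a\<^sub>1 a\<^sub>2 (regular_part d s\<^sub>1) (regular_part d s\<^sub>2))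
           \<le> cyc_ham n s\<^sub>1 (shift_by m s\<^sub>2)"
proof -
  define R where "R = {x \<in> {0..<d}. regular_part d s\<^sub>1 (x + a\<^sub>1) \<noteq> regular_part d s\<^sub>2 (x + a\<^sub>2)}"
  define Y where "Y = {y \<in> {0..<n}. s\<^sub>1 y \<noteq> shift_by m s\<^sub>2 y}"
  have finR: "finite R" unfolding R_def by (rule finite_subset[of _ "{0..<d}"]) auto
  have finY: "finite Y" unfolding Y_def by (rule finite_subset[of _ "{0..<n}"]) auto
  have "R \<subseteq> (\<lambda>y. (y - a\<^sub>1) mod d) ` Y"
  proof
    fix x assume x: "x \<in> R"
    have 2: "d dvd (x + a\<^sub>2) - (x + a\<^sub>1 + m)" using assms(6) by (simp add: algebra_simps)
    have "\<exists>h. s\<^sub>1 (x + a\<^sub>1 + d * h) \<noteq> s\<^sub>2 (x + a\<^sub>1 + d * h + m)"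
    proof (rule ccontr)
      assume "\<not> ?thesis"
      then have "s\<^sub>1 (x + a\<^sub>1 + d * h) = s\<^sub>2 (x + a\<^sub>1 + d * h + m)" for h by blast
      moreover have "x + a\<^sub>1 + d * h + m = x + a\<^sub>1 + m + d * h" for h by simp
      ultimately have e: "s\<^sub>2 (x + a\<^sub>1 + m + d * h) = s\<^sub>1 (x + a\<^sub>1 + d * h)" for h by metis
      have e0: "s\<^sub>2 (x + a\<^sub>1 + m) = s\<^sub>1 (x + a\<^sub>1)" using e[of 0] by simp
      have "regular_part d s\<^sub>2 (x + a\<^sub>1 + m) = regular_part d s\<^sub>1 (x + a\<^sub>1)"
        unfolding regular_part_def special_def by (simp only: e e0)
      then show False
        using x periodic_cong[OF periodic_regular_part 2, of s\<^sub>2] by (simp add: R_def)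
    qed
    then obtain h where h: "s\<^sub>1 (x + a\<^sub>1 + d * h) \<noteq> s\<^sub>2 (x + a\<^sub>1 + d * h + m)" by blast
    define y where "y = (x + a\<^sub>1 + d * h) mod n"
    have y: "n dvd y - (x + a\<^sub>1 + d * h)" by (simp add: y_def mod_eq_dvd_iff[symmetric])
    have "s\<^sub>1 y = s\<^sub>1 (x + a\<^sub>1 + d * h)" by (rule periodic_cong[OF assms(1) y])
    moreover have "shift_by m s\<^sub>2 y = shift_by m s\<^sub>2 (x + a\<^sub>1 + d * h)"
      by (rule periodic_cong[OF periodic_shift[OF assms(2)] y])
    ultimately have "y \<in> Y" using h assms(3) by (simp add: Y_def y_def shift_by_def)
    moreover have "x = (y - a\<^sub>1) mod d"
    proof -
      have "d dvd y - (x + a\<^sub>1 + d * h) + d * h" 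
        by (intro dvd_add dvd_trans[OF assms(5) y]) simp
      then have "d dvd (y - a\<^sub>1) - x" by (simp add: algebra_simps)
      then have "(y - a\<^sub>1) mod d = x mod d" by (simp add: mod_eq_dvd_iff)
      then show ?thesis using x by (simp add: R_def)
    qed
    ultimately show "x \<in> (\<lambda>y. (y - a\<^sub>1) mod d) ` Y" by blast
  qed
  then have "card R \<le> card ((\<lambda>y. (y - a\<^sub>1) mod d) ` Y)" using finY by (intro card_mono) auto
  also have "\<dots> \<le> card Y" by (rule card_image_le[OF finY])
  finally have "card R \<le> card Y" .
  moreover have "card (mismatches d a\<^sub>1 a\<^sub>2 (regular_part d s\<^sub>1) (regular_part d s\<^sub>2)) \<le> card R"
    unfolding mismatches_def R_def[symmetric] by (rule card_image_le[OF finR])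
  ultimately show ?thesis by (simp add: cyc_ham_def Y_def)
qed

section \<open>Linear sketches with random weights\<close>

definition lin_sketch :: "(int \<times> 'b \<Rightarrow> int) \<Rightarrow> int \<Rightarrow> int \<Rightarrow> (int \<Rightarrow> 'b) \<Rightarrow> int" where
  "lin_sketch r d a T = (\<Sum>x\<in>{0..<d}. r (x, T (x + a)))"

definition diff_sum :: "(int \<times> 'b \<Rightarrow> int) \<Rightarrow> (int \<times> 'b \<times> 'b) set \<Rightarrow> int" where
  "diff_sum r W = (\<Sum>(x, u, v)\<in>W. r (x, u) - r (x, v))"

text \<open>One triple per position, with distinct letters, is what makes W recoverable: {(x, u, w),
  (x, w, v)} and {(x, u, v)} have the same \<open>diff_sum\<close> for all weights.\<close>

definition mismatch_set :: "(int \<times> 'b \<times> 'b) set \<Rightarrow> bool" where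
  "mismatch_set W \<longleftrightarrow> finite W \<and> (\<forall>x u v. (x, u, v) \<in> W \<longrightarrow> u \<noteq> v) \<and>
     (\<forall>x u v u' v'. (x, u, v) \<in> W \<longrightarrow> (x, u', v') \<in> W \<longrightarrow> u = u' \<and> v = v')"

lemma mismatch_set_mismatches: "mismatch_set (mismatches d a\<^sub>1 a\<^sub>2 T\<^sub>1 T\<^sub>2)"
proof -
  have "finite {x \<in> {0..<d}. T\<^sub>1 (x + a\<^sub>1) \<noteq> T\<^sub>2 (x + a\<^sub>2)}"
    by (rule finite_subset[of _ "{0..<d}"]) auto
  then have "finite (mismatches d a\<^sub>1 a\<^sub>2 T\<^sub>1 T\<^sub>2)" unfolding mismatches_def by (rule finite_imageI)
  then show ?thesis by (simp add: mismatch_set_def mismatches_iff)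
qed

text \<open>Positions with equal letters cancel, so two strings sketched separately can be compared
  by subtraction.\<close>

lemma lin_sketch_diff:
  "lin_sketch r d a\<^sub>1 T\<^sub>1 - lin_sketch r d a\<^sub>2 T\<^sub>2 = diff_sum r (mismatches d a\<^sub>1 a\<^sub>2 T\<^sub>1 T\<^sub>2)"
proof -
  define R where "R = {x \<in> {0..<d}. T\<^sub>1 (x + a\<^sub>1) \<noteq> T\<^sub>2 (x + a\<^sub>2)}"
  have "diff_sum r (mismatches d a\<^sub>1 a\<^sub>2 T\<^sub>1 T\<^sub>2)
      = (\<Sum>x\<in>R. r (x, T\<^sub>1 (x + a\<^sub>1)) - r (x, T\<^sub>2 (x + a\<^sub>2)))"
    unfolding diff_sum_def mismatches_def R_def[symmetric]
    by (subst sum.reindex) (auto simp: inj_on_def)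
  also have "\<dots> = (\<Sum>x\<in>{0..<d}. r (x, T\<^sub>1 (x + a\<^sub>1)) - r (x, T\<^sub>2 (x + a\<^sub>2)))"
    by (rule sum.mono_neutral_left) (auto simp: R_def)
  finally show ?thesis by (simp add: lin_sketch_def sum_subtractf)
qed

text \<open>As a linear form in the weights, \<open>diff_sum\<close> has at i the coefficient
  obtained by taking the indicator of i as weights.\<close>

lemma diff_sum_upd:
  "diff_sum (r(i := v)) W = diff_sum r W + (v - r i) * diff_sum (\<lambda>j. of_bool (j = i)) W"
  unfolding diff_sum_def sum_distrib_left sum.distrib[symmetric]
  by (rule sum.cong) (auto simp: algebra_simps)

lemma diff_sum_delta:
  assumes "mismatch_set W"
  shows "(x, u, v) \<in> W \<Longrightarrow> diff_sum (\<lambda>j. of_bool (j = (x, z))) W = of_bool (u = z) - of_bool (v = z)"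
    and "(\<And>u v. (x, u, v) \<notin> W) \<Longrightarrow> diff_sum (\<lambda>j. of_bool (j = (x, z))) W = 0"
proof -
  have fin: "finite W" using assms by (simp add: mismatch_set_def)
  show "diff_sum (\<lambda>j. of_bool (j = (x, z))) W = of_bool (u = z) - of_bool (v = z)" if "(x, u, v) \<in> W"
  proof -
    have "diff_sum (\<lambda>j. of_bool (j = (x, z))) W =
        (\<Sum>(y, u, v)\<in>{(x, u, v)}. of_bool ((y, u) = (x, z)) - of_bool ((y, v) = (x, z)))"
      unfolding diff_sum_def
    proof (rule sum.mono_neutral_right[OF fin])
      have "y \<noteq> x" if "(y, u', v') \<in> W - {(x, u, v)}" for y u' v'
        using that \<open>(x, u, v) \<in> W\<close> assms unfolding mismatch_set_def by blast
      note ne = this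
      show "\<forall>i\<in>W - {(x, u, v)}.
          (case i of (y, u, v) \<Rightarrow> of_bool ((y, u) = (x, z)) - of_bool ((y, v) = (x, z))) = (0 :: int)"
      proof
        fix i assume i: "i \<in> W - {(x, u, v)}"
        obtain y u' v' where "i = (y, u', v')" by (cases i)
        then show "(case i of (y, u, v) \<Rightarrow> of_bool ((y, u) = (x, z)) - of_bool ((y, v) = (x, z))) = (0 :: int)"
          using ne[of y u' v'] i by simp
      qed
    qed (use that in simp)
    then show ?thesis by simp
  qed
  show "diff_sum (\<lambda>j. of_bool (j = (x, z))) W = 0" if "\<And>u v. (x, u, v) \<notin> W"
    unfolding diff_sum_def by (rule sum.neutral) (use that in auto)
qed

text \<open>The coefficient can be \<open>\<plusminus>2\<close>, which is why the modulus of the sketch has to be odd.\<close>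
lemma distinguishing_coefficient:
  assumes "mismatch_set W" "mismatch_set W'" "W \<noteq> W'"
  shows "\<exists>(x, u, v) \<in> W \<union> W'. \<exists>z\<in>{u, v}.
    diff_sum (\<lambda>j. of_bool (j = (x, z))) W - diff_sum (\<lambda>j. of_bool (j = (x, z))) W' \<in> {-2, -1, 1, 2}"
proof -
  have main: "\<exists>z\<in>{u, v}. diff_sum (\<lambda>j. of_bool (j = (x, z))) W
      - diff_sum (\<lambda>j. of_bool (j = (x, z))) W' \<in> {-1, 1, 2}"
    if W: "mismatch_set W" "mismatch_set W'" "(x, u, v) \<in> W" "(x, u, v) \<notin> W'" 
    for W W' :: "(int \<times> 'a \<times> 'a) set" and x u v
  proof -
    have uv: "u \<noteq> v" using W(1,3) unfolding mismatch_set_def by blast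
    show ?thesis
    proof (cases "\<exists>u' v'. (x, u', v') \<in> W'")
      case False
      then have "diff_sum (\<lambda>j. of_bool (j = (x, u))) W' = 0" by (intro diff_sum_delta(2)[OF W(2)]) blast
      then show ?thesis using diff_sum_delta(1)[OF W(1,3), of u] uv by (intro bexI[of _ u]) auto
    next
      case True
      then obtain u' v' where W': "(x, u', v') \<in> W'" by auto
      have ne: "u' \<noteq> v'" using W(2) W' unfolding mismatch_set_def by blast
      have ne': "\<not> (u' = u \<and> v' = v)" using W(4) W' by auto
      note delta = diff_sum_delta(1)[OF W(1,3)] diff_sum_delta(1)[OF W(2) W']
      show ?thesis
      \<comment> \<open>With u' = u the second letters differ, and z = v gives coefficient -1;
        otherwise z = u gives 1, or 2 if v' = u.\<close>
      proof (cases "u' = u")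
        case True
        then show ?thesis unfolding delta using ne ne' uv by (intro bexI[of _ v]) auto
      next
        case False
        then show ?thesis unfolding delta using uv by (intro bexI[of _ u]) auto
      qed
    qed
  qed
  obtain i where "i \<in> W \<and> i \<notin> W' \<or> i \<in> W' \<and> i \<notin> W" using assms(3) by blast
  moreover obtain x u v where "i = (x, u, v)" by (cases i)
  ultimately have "(x, u, v) \<in> W \<and> (x, u, v) \<notin> W' \<or> (x, u, v) \<in> W' \<and> (x, u, v) \<notin> W" by simp
  then show ?thesis
  proof
    assume "(x, u, v) \<in> W \<and> (x, u, v) \<notin> W'"
    then have *: "(x, u, v) \<in> W \<union> W'" and m: "\<exists>z\<in>{u, v}. diff_sum (\<lambda>j. of_bool (j = (x, z))) W
      - diff_sum (\<lambda>j. of_bool (j = (x, z))) W' \<in> {-1, 1, 2}" using main[OF assms(1,2)] by blast+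
    from m have "\<exists>z\<in>{u, v}. diff_sum (\<lambda>j. of_bool (j = (x, z))) W
      - diff_sum (\<lambda>j. of_bool (j = (x, z))) W' \<in> {-2, -1, 1, 2}" by blast
    then show ?thesis using * by blast
  next
    assume "(x, u, v) \<in> W' \<and> (x, u, v) \<notin> W"
    then have *: "(x, u, v) \<in> W \<union> W'" and "\<exists>z\<in>{u, v}. diff_sum (\<lambda>j. of_bool (j = (x, z))) W'
      - diff_sum (\<lambda>j. of_bool (j = (x, z))) W \<in> {-1, 1, 2}" using main[OF assms(2,1)] by blast+
    then obtain z where z: "z \<in> {u, v}" "diff_sum (\<lambda>j. of_bool (j = (x, z))) W'
      - diff_sum (\<lambda>j. of_bool (j = (x, z))) W \<in> {-1, 1, 2}" by blast
    then have "diff_sum (\<lambda>j. of_bool (j = (x, z))) W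
      - diff_sum (\<lambda>j. of_bool (j = (x, z))) W' \<in> {-2, -1, 1, 2}" by auto
    then show ?thesis using * z(1) by blast
  qed
qed

text \<open>Forgetting coordinate i is injective on B. This is the counting form of revealing one
  random coordinate last.\<close>

lemma card_PiE_determined_coordinate:
  assumes "finite I" "i \<in> I" "finite A" "B \<subseteq> I \<rightarrow>\<^sub>E A"
    and "\<And>r v. r \<in> B \<Longrightarrow> r(i := v) \<in> B \<Longrightarrow> v = r i"
  shows "card B \<le> card A ^ (card I - 1)"
proof -
  have "inj_on (\<lambda>r. restrict r (I - {i})) B"
  proof (rule inj_onI)
    fix r r' assume r: "r \<in> B" "r' \<in> B" and eq: "restrict r (I - {i}) = restrict r' (I - {i})"
    have "r' = r(i := r' i)"
    proof
      fix j show "r' j = (r(i := r' i)) j"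
      proof (cases "j \<in> I - {i}")
        case True
        then show ?thesis using fun_cong[OF eq, of j] by simp
      next
        case False
        then have "j = i \<or> j \<notin> I" by auto
        moreover have "r j = r' j" if "j \<notin> I"
          using r assms(4) that by (metis PiE_arb subsetD)
        ultimately show ?thesis by auto
      qed
    qed
    then show "r = r'" using assms(5)[of r "r' i"] r by (metis fun_upd_triv)
  qed
  then have "card B = card ((\<lambda>r. restrict r (I - {i})) ` B)" by (simp add: card_image)
  also have "\<dots> \<le> card ((I - {i}) \<rightarrow>\<^sub>E A)"
  proof (rule card_mono)
    show "finite ((I - {i}) \<rightarrow>\<^sub>E A)" using assms(1,3) by (intro finite_PiE) auto
    have "restrict r (I - {i}) \<in> (I - {i}) \<rightarrow>\<^sub>E A" if "r \<in> B" for r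
    proof -
      have "r \<in> I \<rightarrow>\<^sub>E A" using that assms(4) by blast
      then show ?thesis by auto
    qed
    then show "(\<lambda>r. restrict r (I - {i})) ` B \<subseteq> (I - {i}) \<rightarrow>\<^sub>E A" by blast
  qed
  also have "\<dots> = card A ^ (card I - 1)" using assms by (simp add: card_PiE)
  finally show ?thesis .
qed

text \<open>With all weights but one fixed, the difference is affine in the remaining weight, and
  its slope is a unit modulo N. So at most one of the N values of that weight makes it
  divisible.\<close>

lemma prob_sketch_collision:
  fixes N :: int
  assumes "finite J" "finite A" "N > 0" "odd N" "mismatch_set W" "mismatch_set W'" "W \<noteq> W'"
    and "W \<subseteq> J \<times> A \<times> A" "W' \<subseteq> J \<times> A \<times> A"
  shows "measure_pmf.prob (pmf_of_set ((J \<times> A) \<rightarrow>\<^sub>E {0..<N})) {r. N dvd diff_sum r W - diff_sum r W'} \<le> 1 / real_of_int N"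
proof -
  define \<Omega> where "\<Omega> = (J \<times> A) \<rightarrow>\<^sub>E {0..<N}"
  define B where "B = {r \<in> \<Omega>. N dvd diff_sum r W - diff_sum r W'}"
  obtain x u v z where i: "(x, u, v) \<in> W \<union> W'" "z \<in> {u, v}"
    and c: "diff_sum (\<lambda>j. of_bool (j = (x, z))) W - diff_sum (\<lambda>j. of_bool (j = (x, z))) W' \<in> {-2, -1, 1, 2}"
    using distinguishing_coefficient[OF assms(5,6,7)] by blast
  define i where "i = (x, z)"
  define c where "c = diff_sum (\<lambda>j. of_bool (j = i)) W - diff_sum (\<lambda>j. of_bool (j = i)) W'"
  have "coprime N c" using c assms(4) unfolding c_def i_def by auto
  have iI: "i \<in> J \<times> A" using i assms(8,9) by (auto simp: i_def)
  have fin: "finite (J \<times> A)" "finite \<Omega>" using assms(1,2) by (auto simp: \<Omega>_def intro!: finite_PiE)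
  have "card B \<le> card {0..<N} ^ (card (J \<times> A) - 1)"
  proof (rule card_PiE_determined_coordinate[OF fin(1) iI])
    fix r w assume r: "r \<in> B" "r(i := w) \<in> B"
    have "N dvd (diff_sum (r(i := w)) W - diff_sum (r(i := w)) W') - (diff_sum r W - diff_sum r W')"
      using r unfolding B_def by (simp only: mem_Collect_eq dvd_diff)
    also have "\<dots> = (w - r i) * c" unfolding diff_sum_upd c_def by (simp add: algebra_simps)
    finally have "N dvd w - r i" using \<open>coprime N c\<close> by (simp add: coprime_dvd_mult_left_iff)
    moreover have "r i \<in> {0..<N}" "(r(i := w)) i \<in> {0..<N}"
      using r iI unfolding B_def \<Omega>_def by blast+
    ultimately show "w = r i" by (auto simp: mod_eq_dvd_iff[symmetric])
  qed (auto simp: B_def \<Omega>_def)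
  then have B: "card B \<le> nat N ^ (card (J \<times> A) - 1)" by simp
  have "card (J \<times> A) > 0" using iI fin card_gt_0_iff by blast
  moreover have "card \<Omega> = nat N ^ card (J \<times> A)"
    unfolding \<Omega>_def card_PiE[OF fin(1)] by simp
  ultimately have \<Omega>: "card \<Omega> = nat N * nat N ^ (card (J \<times> A) - 1)"
    by (simp add: power_eq_if)
  then have "card \<Omega> > 0" using assms(3) by simp
  then have "\<Omega> \<noteq> {}" by auto
  then have "measure_pmf.prob (pmf_of_set \<Omega>) {r. N dvd diff_sum r W - diff_sum r W'} = card B / card \<Omega>"
    using fin by (simp add: measure_pmf_of_set B_def Int_def)
  also have "\<dots> \<le> real (nat N ^ (card (J \<times> A) - 1)) / card \<Omega>"
    using B by (intro divide_right_mono) (simp_all only: of_nat_le_iff of_nat_0_le_iff)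
  also have "\<dots> = 1 / real_of_int N" unfolding \<Omega> using assms(3) by simp
  finally show ?thesis unfolding \<Omega>_def .
qed

text \<open>Union bound over the sets of at most k triples, with W fixed before the weights are
  drawn.\<close>

lemma prob_sketch_ambiguous:
  fixes N :: int
  assumes "finite J" "finite A" "N > 0" "odd N" "mismatch_set W" "W \<subseteq> J \<times> A \<times> A"
  shows "measure_pmf.prob (pmf_of_set ((J \<times> A) \<rightarrow>\<^sub>E {0..<N}))
      {r. \<exists>W'\<subseteq>J \<times> A \<times> A. mismatch_set W' \<and> card W' \<le> k \<and> W' \<noteq> W \<and> N dvd diff_sum r W - diff_sum r W'}
    \<le> real ((card J * card A * card A + 1) ^ k) / real_of_int N"
proof -
  define V where "V = {W'. W' \<subseteq> J \<times> A \<times> A \<and> card W' \<le> k}"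
  define V' where "V' = {W'\<in>V. mismatch_set W' \<and> W' \<noteq> W}"
  let ?p = "pmf_of_set ((J \<times> A) \<rightarrow>\<^sub>E {0..<N})"
  have fin: "finite (J \<times> A \<times> A)" using assms by simp
  have finV: "finite V" unfolding V_def by (rule finite_bounded_subsets[OF fin])
  have finV': "finite V'" using finV by (simp add: V'_def)
  have "measure_pmf.prob ?p {r. \<exists>W'\<subseteq>J \<times> A \<times> A. mismatch_set W' \<and> card W' \<le> k \<and> W' \<noteq> W \<and> N dvd diff_sum r W - diff_sum r W'}
      = measure_pmf.prob ?p (\<Union>W'\<in>V'. {r. N dvd diff_sum r W - diff_sum r W'})"
    by (rule arg_cong[where f = "measure_pmf.prob ?p"]) (auto simp: V_def V'_def)
  also have "\<dots> \<le> (\<Sum>W'\<in>V'. measure_pmf.prob ?p {r. N dvd diff_sum r W - diff_sum r W'})"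
    by (rule measure_pmf.finite_measure_subadditive_finite) (use finV' in auto)
  also have "\<dots> \<le> (\<Sum>W'\<in>V'. 1 / real_of_int N)"
    by (intro sum_mono prob_sketch_collision) (use assms in \<open>auto simp: V'_def V_def\<close>)
  also have "\<dots> = card V' / real_of_int N" by simp
  also have "\<dots> \<le> real ((card J * card A * card A + 1) ^ k) / real_of_int N"
  proof -
    have "card V' \<le> card V" using finV by (intro card_mono) (auto simp: V'_def)
    also have "\<dots> \<le> (card J * card A * card A + 1) ^ k"
      using card_bounded_subsets[OF fin, of k] by (simp add: V_def card_cartesian_product mult.assoc)
    finally have "real (card V') \<le> real ((card J * card A * card A + 1) ^ k)" by (simp only: of_nat_le_iff)
    then show ?thesis using assms(3) by (intro divide_right_mono) auto
  qed
  finally show ?thesis .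
qed

section \<open>Minimum-wise sampling\<close>

text \<open>Fubini: condition on the first component, then average. The bound is allowed to vary
  with x because the failure bound for a random order depends on the sampled offsets.\<close>

lemma prob_pair_pmf_le_expectation:
  fixes f :: "'a \<Rightarrow> real"
  assumes int: "integrable (measure_pmf p) f"
    and le: "\<And>x. x \<in> set_pmf p \<Longrightarrow> measure_pmf.prob q {y. (x, y) \<in> M} \<le> f x"
  shows "measure_pmf.prob (pair_pmf p q) M \<le> measure_pmf.expectation p f"
proof -
  define g where "g x = measure_pmf.prob q {y. (x, y) \<in> M}" for x
  have intg: "integrable (measure_pmf p) g"
    by (rule measure_pmf.integrable_const_bound[where B = 1]) (simp_all add: g_def)
  have "ennreal (measure_pmf.prob (pair_pmf p q) M) = (\<integral>\<^sup>+z. indicator M z \<partial>pair_pmf p q)"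
    by (simp add: measure_pmf.emeasure_eq_measure[symmetric])
  also have "\<dots> = (\<integral>\<^sup>+x. \<integral>\<^sup>+y. indicator M (x, y) \<partial>q \<partial>p)" by (rule nn_integral_pair_pmf')
  also have "\<dots> = (\<integral>\<^sup>+x. ennreal (g x) \<partial>p)"
  proof (rule nn_integral_cong)
    fix x
    have "(\<integral>\<^sup>+y. indicator M (x, y) \<partial>q) = (\<integral>\<^sup>+y. indicator {y. (x, y) \<in> M} y \<partial>q)"
      by (rule nn_integral_cong) (simp add: indicator_def)
    then show "(\<integral>\<^sup>+y. indicator M (x, y) \<partial>q) = ennreal (g x)"
      by (simp add: g_def measure_pmf.emeasure_eq_measure)
  qed
  also have "\<dots> = ennreal (measure_pmf.expectation p g)"
    by (rule nn_integral_eq_integral[OF intg]) (simp add: g_def)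
  finally have "measure_pmf.prob (pair_pmf p q) M = measure_pmf.expectation p g"
    by (simp add: g_def integral_nonneg_AE)
  also have "\<dots> \<le> measure_pmf.expectation p f"
    by (rule integral_mono_AE[OF intg int]) (use le in \<open>simp add: AE_measure_pmf_iff g_def\<close>)
  finally show ?thesis .
qed

lemma prob_pair_pmf_le:
  assumes "\<And>x. x \<in> set_pmf p \<Longrightarrow> measure_pmf.prob q {y. (x, y) \<in> M} \<le> b"
  shows "measure_pmf.prob (pair_pmf p q) M \<le> b"
  using prob_pair_pmf_le_expectation[where f = "\<lambda>_. b", OF _ assms] by simp

lemma prob_pair_pmf_fst: "measure_pmf.prob (pair_pmf p q) {z. fst z \<in> A} = measure_pmf.prob p A"
proof -
  have "measure_pmf.prob p A = measure_pmf.prob (map_pmf fst (pair_pmf p q)) A"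
    by (simp only: map_fst_pair_pmf)
  also have "\<dots> = measure_pmf.prob (pair_pmf p q) (fst -` A)" by (rule measure_map_pmf)
  finally show ?thesis by (simp add: vimage_def)
qed

text \<open>A multiset of values represented as a set, so that minimum-wise sampling picks values
  according to their multiplicity.\<close>
definition occ_set :: "'i set \<Rightarrow> ('i \<Rightarrow> 'c) \<Rightarrow> ('c \<times> nat) set" where
  "occ_set I f = {(c, t). t < card {i \<in> I. f i = c}}"

lemma occ_set_Sigma:
  assumes "finite I"
  shows "occ_set I f = (SIGMA c:f ` I. {..<card {i \<in> I. f i = c}})"
proof -
  have "c \<in> f ` I" if "t < card {i \<in> I. f i = c}" for c t
  proof -
    have "{i \<in> I. f i = c} \<noteq> {}" using that by (metis card.empty not_less_zero)
    then show ?thesis by blast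
  qed
  then show ?thesis by (auto simp: occ_set_def)
qed

lemma card_occ_set:
  assumes "finite I"
  shows "card (occ_set I f) = card I" "finite (occ_set I f)"
proof -
  have "card (occ_set I f) = (\<Sum>c\<in>f ` I. card {i \<in> I. f i = c})"
    unfolding occ_set_Sigma[OF assms] using assms by (subst card_SigmaI) auto
  also have "\<dots> = card I"
    using sum.image_gen[OF assms, of "\<lambda>_. 1::nat" f] by simp
  finally show "card (occ_set I f) = card I" .
  show "finite (occ_set I f)" unfolding occ_set_Sigma[OF assms] using assms by auto
qed

text \<open>\<open>to_nat\<close> linearly orders any countable type; applied after a uniformly
  random permutation it gives a random order.\<close>

definition is_first :: "('u::countable \<Rightarrow> 'u) \<Rightarrow> 'u set \<Rightarrow> 'u \<Rightarrow> bool" where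
  "is_first \<pi> Y y \<longleftrightarrow> y \<in> Y \<and> (\<forall>z\<in>Y. to_nat (\<pi> y) \<le> to_nat (\<pi> z))"

definition first_of :: "('u::countable \<Rightarrow> 'u) \<Rightarrow> 'u set \<Rightarrow> 'u" where
  "first_of \<pi> Y = (SOME y. is_first \<pi> Y y)"

lemma is_first_unique:
  assumes "inj \<pi>" "is_first \<pi> Y y" "is_first \<pi> Y z"
  shows "y = z"
proof -
  have "to_nat (\<pi> y) = to_nat (\<pi> z)" 
    using assms(2,3) unfolding is_first_def by (meson order_antisym)
  then show ?thesis using assms(1) by (simp add: inj_eq)
qed

lemma ex_is_first:
  assumes "Y \<noteq> {}"
  shows "\<exists>y. is_first \<pi> Y y"
proof -
  obtain y where "y \<in> Y" "\<And>z. z \<in> Y \<Longrightarrow> to_nat (\<pi> y) \<le> to_nat (\<pi> z)"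
    using assms ex_has_least_nat[of "\<lambda>y. y \<in> Y" _ "\<lambda>y. to_nat (\<pi> y)"] by blast
  then show ?thesis by (auto simp: is_first_def)
qed

lemma first_of_eq:
  assumes "inj \<pi>" "is_first \<pi> Y y"
  shows "first_of \<pi> Y = y"
  unfolding first_of_def using assms is_first_unique by (metis someI)

text \<open>By symmetry: composing with the transposition of y and z turns the permutations that put
  z first into those that put y first, and these events are disjoint for different elements of
  Y.\<close>

lemma prob_is_first:
  fixes U :: "'u::countable set"
  assumes U: "finite U" "Y \<subseteq> U" and y: "y \<in> Y"
  shows "measure_pmf.prob (pmf_of_set {\<pi>. \<pi> permutes U}) {\<pi>. is_first \<pi> Y y} \<le> 1 / card Y"
proof -
  define \<Omega> where "\<Omega> = {\<pi>. \<pi> permutes U}"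
  define E where "E z = {\<pi> \<in> \<Omega>. is_first \<pi> Y z}" for z
  have fin: "finite \<Omega>" "\<Omega> \<noteq> {}"
    unfolding \<Omega>_def using finite_permutations[OF U(1)] permutes_id[of U] by blast+
  have finY: "finite Y" by (rule finite_subset[OF U(2,1)])
  have "card (E z) = card (E y)" if z: "z \<in> Y" for z
  proof (rule bij_betw_same_card)
    let ?t = "Transposition.transpose y z" and ?h = "\<lambda>\<pi>. \<pi> \<circ> Transposition.transpose y z"
    have t: "?t permutes U" using y z U(2) by (auto intro: permutes_swap_id)
    have closed: "?h \<pi> \<in> \<Omega>" if "\<pi> \<in> \<Omega>" for \<pi>
      using that t by (auto simp: \<Omega>_def intro: permutes_compose)
    have tY: "?t w \<in> Y" if "w \<in> Y" for w using that y z by (auto simp: Transposition.transpose_def)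
    have inv: "?h (?h \<pi>) = \<pi>" for \<pi> :: "'u \<Rightarrow> 'u" by (simp add: fun_eq_iff)
    have 1: "is_first (?h \<pi>) Y y" if "is_first \<pi> Y z" for \<pi>
      using that tY y by (auto simp: is_first_def)
    have 2: "is_first (?h \<pi>) Y z" if "is_first \<pi> Y y" for \<pi>
      using that tY z by (auto simp: is_first_def)
    show "bij_betw ?h (E z) (E y)"
      by (rule bij_betw_byWitness[where f' = ?h]) (use closed inv 1 2 in \<open>auto simp: E_def\<close>)
  qed
  then have "(\<Sum>z\<in>Y. card (E z)) = card Y * card (E y)" by simp
  moreover have "(\<Sum>z\<in>Y. card (E z)) = card (\<Union>z\<in>Y. E z)"
  proof (rule card_UN_disjoint[symmetric])
    show "\<forall>i\<in>Y. \<forall>j\<in>Y. i \<noteq> j \<longrightarrow> E i \<inter> E j = {}"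
    proof (intro ballI impI equals0I)
      fix i j \<pi> assume "i \<noteq> j" "\<pi> \<in> E i \<inter> E j"
      moreover from this have "inj \<pi>" by (auto simp: E_def \<Omega>_def permutes_inj)
      ultimately show False using is_first_unique[of \<pi> Y i j] by (auto simp: E_def)
    qed
  qed (use finY fin in \<open>auto simp: E_def\<close>)
  moreover have "card (\<Union>z\<in>Y. E z) \<le> card \<Omega>" by (rule card_mono) (use fin in \<open>auto simp: E_def\<close>)
  ultimately have "card Y * card (E y) \<le> card \<Omega>" by simp
  then have le: "real (card Y) * real (card (E y)) \<le> real (card \<Omega>)" by (simp flip: of_nat_mult)
  have pos: "card Y > 0" "card \<Omega> > 0" using y finY fin by (auto simp: card_gt_0_iff)
  have "measure_pmf.prob (pmf_of_set \<Omega>) {\<pi>. is_first \<pi> Y y} = card (E y) / card \<Omega>"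
    using fin by (simp add: measure_pmf_of_set E_def Int_def)
  also have "\<dots> \<le> 1 / card Y" using le pos by (simp add: field_simps)
  finally show ?thesis by (simp add: \<Omega>_def)
qed

lemma prob_first_in:
  fixes U :: "'u::countable set"
  assumes U: "finite U" "Y \<subseteq> U" and B: "B \<subseteq> Y"
  shows "measure_pmf.prob (pmf_of_set {\<pi>. \<pi> permutes U}) {\<pi>. \<exists>y\<in>B. is_first \<pi> Y y} \<le> card B / card Y"
proof -
  let ?p = "pmf_of_set {\<pi>. \<pi> permutes U}"
  have "finite B" by (rule finite_subset[OF subset_trans[OF B U(2)] U(1)])
  have "measure_pmf.prob ?p {\<pi>. \<exists>y\<in>B. is_first \<pi> Y y} = measure_pmf.prob ?p (\<Union>y\<in>B. {\<pi>. is_first \<pi> Y y})"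
    by (rule arg_cong[where f = "measure_pmf.prob ?p"]) auto
  also have "\<dots> \<le> (\<Sum>y\<in>B. measure_pmf.prob ?p {\<pi>. is_first \<pi> Y y})"
    by (rule measure_pmf.finite_measure_subadditive_finite) (use \<open>finite B\<close> in auto)
  also have "\<dots> \<le> (\<Sum>y\<in>B. 1 / card Y)" using assms by (intro sum_mono prob_is_first) auto
  finally show ?thesis by simp
qed

section \<open>Contexts at random offsets\<close>

definition context_at :: "int list \<Rightarrow> (int \<Rightarrow> 'a) \<Rightarrow> int \<Rightarrow> 'a list" where
  "context_at R s i = map (\<lambda>r. s (i + r)) R"

text \<open>Offsets may repeat, so a uniform list consists of L independent offsets and the
  probability of equal contexts is an exact L-th power.\<close>

definition offset_lists :: "nat \<Rightarrow> nat \<Rightarrow> int list set" where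
  "offset_lists n L = {R. set R \<subseteq> {0..<int n} \<and> length R = L}"

lemma finite_offset_lists: "finite (offset_lists n L)"
  unfolding offset_lists_def by (rule finite_lists_length_eq) simp

lemma offset_lists_nonempty: "n > 0 \<Longrightarrow> offset_lists n L \<noteq> {}"
proof -
  assume "n > 0"
  then have "replicate L 0 \<in> offset_lists n L" by (auto simp: offset_lists_def)
  then show ?thesis by blast
qed

lemma prob_context_eq:
  assumes "n > 0"
  shows "measure_pmf.prob (pmf_of_set (offset_lists n L)) {R. context_at R s i = context_at R s' i'}
       = (1 - cyc_ham n (shift_by i s) (shift_by i' s') / n) ^ L"
proof -
  define Q where "Q = {r \<in> {0..<int n}. s (i + r) = s' (i' + r)}"
  define H where "H = {r \<in> {0..<int n}. shift_by i s r \<noteq> shift_by i' s' r}"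
  have Q: "Q = {0..<int n} - H" by (auto simp: Q_def H_def shift_by_def add.commute)
  have fin: "finite Q" "finite H" "H \<subseteq> {0..<int n}"
    unfolding Q by (auto simp: H_def intro: finite_subset[of _ "{0..<int n}"])
  have "card Q = n - card H" unfolding Q by (subst card_Diff_subset[OF fin(2,3)]) simp
  moreover have "card H \<le> n" using card_mono[OF _ fin(3)] by simp
  ultimately have cQ: "real (card Q) / n = 1 - card H / n" using assms by (simp add: field_simps)
  have "offset_lists n L \<inter> {R. context_at R s i = context_at R s' i'} = {R. set R \<subseteq> Q \<and> length R = L}"
    by (auto simp: offset_lists_def context_at_def Q_def)
  then have "card (offset_lists n L \<inter> {R. context_at R s i = context_at R s' i'}) = card Q ^ L"
    using card_lists_length_eq[OF fin(1), of L] by simp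
  moreover have "card (offset_lists n L) = n ^ L"
    unfolding offset_lists_def by (subst card_lists_length_eq) auto
  ultimately have "measure_pmf.prob (pmf_of_set (offset_lists n L)) {R. context_at R s i = context_at R s' i'}
      = (real (card Q) / n) ^ L"
    using finite_offset_lists offset_lists_nonempty[OF assms]
    by (simp add: measure_pmf_of_set power_divide)
  then show ?thesis unfolding cQ by (simp add: cyc_ham_def H_def)
qed

section \<open>Anchors\<close>

text \<open>A finite ground set for the random permutation that does not depend on the string; an
  occurrence number of a context is always below n.\<close>

definition context_universe :: "'a set \<Rightarrow> nat \<Rightarrow> nat \<Rightarrow> ('a list \<times> nat) set" where
  "context_universe A n L = {c. set c \<subseteq> A \<and> length c = L} \<times> {..<n}"

definition anchor_pmf ::
  "'a::countable set \<Rightarrow> nat \<Rightarrow> nat \<Rightarrow> (int list \<times> ('a list \<times> nat \<Rightarrow> 'a list \<times> nat)) pmf" where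
  "anchor_pmf A n L = pair_pmf (pmf_of_set (offset_lists n L))
     (pmf_of_set {\<pi>. \<pi> permutes context_universe A n L})"

definition context_set :: "nat \<Rightarrow> int list \<Rightarrow> (int \<Rightarrow> 'a) \<Rightarrow> ('a list \<times> nat) set" where
  "context_set n R s = occ_set {0..<int n} (context_at R s)"

text \<open>Any position showing the first context will do: once contexts separate the residue
  classes modulo d, all such positions are congruent modulo d.\<close>

definition anchor ::
  "nat \<Rightarrow> int list \<times> ('a::countable list \<times> nat \<Rightarrow> 'a list \<times> nat) \<Rightarrow> (int \<Rightarrow> 'a) \<Rightarrow> int" where
  "anchor n \<omega> s = (SOME i. i \<in> {0..<int n} \<and>
     context_at (fst \<omega>) s i = fst (first_of (snd \<omega>) (context_set n (fst \<omega>) s)))"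

lemma occ_setD: "(c, t) \<in> occ_set I f \<Longrightarrow> \<exists>i\<in>I. f i = c"
proof -
  assume "(c, t) \<in> occ_set I f"
  then have "{i \<in> I. f i = c} \<noteq> {}" by (force simp: occ_set_def)
  then show ?thesis by blast
qed

lemma anchor_spec:
  assumes "n > 0"
  shows "anchor n \<omega> s \<in> {0..<int n}"
    and "context_at (fst \<omega>) s (anchor n \<omega> s) = fst (first_of (snd \<omega>) (context_set n (fst \<omega>) s))"
proof -
  let ?X = "context_set n (fst \<omega>) s"
  have "card ?X = n" unfolding context_set_def by (subst card_occ_set) auto
  then have "?X \<noteq> {}" using assms by auto
  then have "is_first (snd \<omega>) ?X (first_of (snd \<omega>) ?X)"
    unfolding first_of_def by (rule someI_ex[OF ex_is_first])
  then have mem: "first_of (snd \<omega>) ?X \<in> occ_set {0..<int n} (context_at (fst \<omega>) s)"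
    by (simp add: is_first_def context_set_def)
  obtain c t where ct: "first_of (snd \<omega>) ?X = (c, t)" by (cases "first_of (snd \<omega>) ?X")
  have "\<exists>i. i \<in> {0..<int n} \<and> context_at (fst \<omega>) s i = fst (first_of (snd \<omega>) ?X)"
    using occ_setD[OF mem[unfolded ct]] unfolding ct fst_conv by blast
  note * = someI_ex[OF this, folded anchor_def]
  show "anchor n \<omega> s \<in> {0..<int n}" by (rule conjunct1[OF *])
  show "context_at (fst \<omega>) s (anchor n \<omega> s) = fst (first_of (snd \<omega>) ?X)" by (rule conjunct2[OF *])
qed

lemma periodic_context_at:
  assumes "periodic n s"
  shows "periodic n (context_at R s)"
proof -
  have "s (x + n + r) = s (x + r)" for x r
    by (rule periodic_cong[OF assms]) simp
  then show ?thesis unfolding periodic_def context_at_def by simp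
qed

text \<open>A submultiset of both context multisets with one element per position whose context
  survives the mismatches, so that its size is found by counting positions.\<close>

definition common_contexts :: "nat \<Rightarrow> int list \<Rightarrow> int \<Rightarrow> (int \<Rightarrow> 'a) \<Rightarrow> (int \<Rightarrow> 'a) \<Rightarrow> ('a list \<times> nat) set" where
  "common_contexts n R m s\<^sub>1 s\<^sub>2 =
     occ_set {i \<in> {0..<int n}. context_at R s\<^sub>1 i = context_at R s\<^sub>2 (i + m)} (context_at R s\<^sub>1)"

lemma common_contexts_subset:
  assumes "periodic (int n) s\<^sub>2" "n > 0"
  shows "common_contexts n R m s\<^sub>1 s\<^sub>2 \<subseteq> context_set n R s\<^sub>1"
    and "common_contexts n R m s\<^sub>1 s\<^sub>2 \<subseteq> context_set n R s\<^sub>2"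
proof -
  let ?C1 = "context_at R s\<^sub>1" and ?C2 = "context_at R s\<^sub>2" and ?I = "{0..<int n}"
  have fin: "finite {i \<in> ?I. P i}" for P by (rule finite_subset[of _ ?I]) auto
  show "common_contexts n R m s\<^sub>1 s\<^sub>2 \<subseteq> context_set n R s\<^sub>1"
  proof clarify
    fix c t assume "(c, t) \<in> common_contexts n R m s\<^sub>1 s\<^sub>2"
    then have "t < card {i \<in> {i \<in> ?I. ?C1 i = ?C2 (i + m)}. ?C1 i = c}"
      unfolding common_contexts_def occ_set_def by blast
    also have "\<dots> \<le> card {i \<in> ?I. ?C1 i = c}" by (intro card_mono fin) blast
    finally show "(c, t) \<in> context_set n R s\<^sub>1" by (simp add: context_set_def occ_set_def)
  qed
  show "common_contexts n R m s\<^sub>1 s\<^sub>2 \<subseteq> context_set n R s\<^sub>2"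
  proof clarify
    fix c t assume "(c, t) \<in> common_contexts n R m s\<^sub>1 s\<^sub>2"
    then have "t < card {i \<in> {i \<in> ?I. ?C1 i = ?C2 (i + m)}. ?C1 i = c}"
      unfolding common_contexts_def occ_set_def by blast
    also have "\<dots> \<le> card {i \<in> ?I. ?C2 (i + m) = c}" by (intro card_mono fin) auto
    also have "\<dots> = card {i \<in> ?I. ?C2 i = c}"
    proof (rule card_periodic_shift[where P = "\<lambda>i. ?C2 i = c"])
      show "periodic (int n) (\<lambda>i. ?C2 i = c)"
        using periodic_context_at[OF assms(1), of R] by (simp add: periodic_def)
    qed (use assms(2) in simp)
    finally show "(c, t) \<in> context_set n R s\<^sub>2" by (simp add: context_set_def occ_set_def)
  qed
qed

text \<open>Both context sets have n elements and exceed the common part by the number of bad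
  positions, while their union has at least n elements. The quotient bounds the probability that the
  first element of the union is not common.\<close>

lemma card_context_sets_minus_common:
  assumes "periodic (int n) s\<^sub>2" "n > 0"
  shows "real (card (context_set n R s\<^sub>1 \<union> context_set n R s\<^sub>2 - common_contexts n R m s\<^sub>1 s\<^sub>2))
           / card (context_set n R s\<^sub>1 \<union> context_set n R s\<^sub>2)
         \<le> 2 * card {i \<in> {0..<int n}. context_at R s\<^sub>1 i \<noteq> context_at R s\<^sub>2 (i + m)} / n"
proof -
  let ?X1 = "context_set n R s\<^sub>1" and ?X2 = "context_set n R s\<^sub>2" and ?G = "common_contexts n R m s\<^sub>1 s\<^sub>2"
  define B where "B = {i \<in> {0..<int n}. context_at R s\<^sub>1 i \<noteq> context_at R s\<^sub>2 (i + m)}"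
  define Gd where "Gd = {i \<in> {0..<int n}. context_at R s\<^sub>1 i = context_at R s\<^sub>2 (i + m)}"
  have Gd: "Gd = {0..<int n} - B" "B \<subseteq> {0..<int n}" by (auto simp: Gd_def B_def)
  have finB: "finite B" by (rule finite_subset[OF Gd(2)]) simp
  have fG: "finite Gd" unfolding Gd by simp
  have cB: "card B \<le> n" using card_mono[OF _ Gd(2)] by simp
  have cX: "card ?X1 = n" "card ?X2 = n" "finite ?X1" "finite ?X2"
    unfolding context_set_def using card_occ_set[of "{0..<int n}"] by auto
  have "card ?G = card Gd" unfolding common_contexts_def Gd_def[symmetric] by (rule card_occ_set(1)[OF fG])
  also have "\<dots> = n - card B" unfolding Gd(1) by (subst card_Diff_subset[OF finB Gd(2)]) simp
  finally have cG: "card ?G = n - card B" .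
  have sub: "?G \<subseteq> ?X1" "?G \<subseteq> ?X2" using common_contexts_subset[OF assms] by blast+
  have finG: "finite ?G" by (rule finite_subset[OF sub(1) cX(3)])
  have "?X1 \<union> ?X2 - ?G = (?X1 - ?G) \<union> (?X2 - ?G)" by blast
  then have "card (?X1 \<union> ?X2 - ?G) \<le> card (?X1 - ?G) + card (?X2 - ?G)" by (simp add: card_Un_le)
  also have "\<dots> = 2 * card B"
    using cG cX cB by (simp add: card_Diff_subset[OF finG sub(1)] card_Diff_subset[OF finG sub(2)])
  finally have num: "card (?X1 \<union> ?X2 - ?G) \<le> 2 * card B" .
  have den: "n \<le> card (?X1 \<union> ?X2)" using card_mono[of "?X1 \<union> ?X2" ?X1] cX by simp
  have "real (card (?X1 \<union> ?X2 - ?G)) / card (?X1 \<union> ?X2) \<le> real (2 * card B) / real n"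
    using num den assms(2) by (intro frac_le) (simp_all only: of_nat_le_iff of_nat_0_le_iff of_nat_0_less_iff)
  then show ?thesis by (simp add: B_def)
qed

text \<open>If the first element of the union is common, it is first in both sets, so both anchors
  show its context. By separation they are congruent modulo d to positions i and i + m where this
  context occurs in the two strings.\<close>

lemma anchor_shift:
  assumes s: "periodic (int n) s\<^sub>2" "n > 0" "d dvd int n" and inj: "inj \<pi>"
    and sep1: "\<And>x y. x \<in> {0..<int n} \<Longrightarrow> y \<in> {0..<int n} \<Longrightarrow> context_at R s\<^sub>1 x = context_at R s\<^sub>1 y \<Longrightarrow> d dvd y - x"
    and sep2: "\<And>x y. x \<in> {0..<int n} \<Longrightarrow> y \<in> {0..<int n} \<Longrightarrow> context_at R s\<^sub>2 x = context_at R s\<^sub>2 y \<Longrightarrow> d dvd y - x"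
    and u: "u \<in> common_contexts n R m s\<^sub>1 s\<^sub>2" "is_first \<pi> (context_set n R s\<^sub>1 \<union> context_set n R s\<^sub>2) u"
  shows "d dvd anchor n (R, \<pi>) s\<^sub>2 - anchor n (R, \<pi>) s\<^sub>1 - m"
proof -
  define a1 where "a1 = anchor n (R, \<pi>) s\<^sub>1"
  define a2 where "a2 = anchor n (R, \<pi>) s\<^sub>2"
  have "is_first \<pi> (context_set n R s\<^sub>1) u" "is_first \<pi> (context_set n R s\<^sub>2) u"
    using u common_contexts_subset[OF s(1,2)] unfolding is_first_def by blast+
  then have "first_of \<pi> (context_set n R s\<^sub>1) = u" "first_of \<pi> (context_set n R s\<^sub>2) = u"
    using first_of_eq[OF inj] by blast+
  then have a: "a1 \<in> {0..<int n}" "context_at R s\<^sub>1 a1 = fst u"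
    "a2 \<in> {0..<int n}" "context_at R s\<^sub>2 a2 = fst u"
    unfolding a1_def a2_def using anchor_spec[OF s(2), of "(R, \<pi>)"] by simp_all
  obtain c t where ct: "u = (c, t)" by (cases u)
  obtain i where i: "i \<in> {0..<int n}" "context_at R s\<^sub>1 i = context_at R s\<^sub>2 (i + m)" "context_at R s\<^sub>1 i = c"
    using occ_setD[OF u(1)[unfolded ct common_contexts_def]] by blast
  have 1: "d dvd i - a1" using i a ct by (intro sep1) auto
  define j where "j = (i + m) mod int n"
  have "context_at R s\<^sub>2 j = c"
    using periodic_mod[OF periodic_context_at[OF s(1)]] i by (simp add: j_def)
  then have 2: "d dvd a2 - j" using a ct s(2) by (intro sep2) (auto simp: j_def)
  have "int n dvd j - (i + m)" by (simp add: j_def mod_eq_dvd_iff[symmetric])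
  then have 3: "d dvd j - (i + m)" by (rule dvd_trans[OF s(3)])
  have "d dvd (i - a1) + ((a2 - j) + (j - (i + m)))" by (intro dvd_add 1 2 3)
  then show ?thesis by (simp add: a1_def a2_def algebra_simps)
qed

lemma context_set_subset_universe:
  assumes "\<And>x. s x \<in> A" "length R = L"
  shows "context_set n R s \<subseteq> context_universe A n L"
proof clarify
  fix c t assume ct: "(c, t) \<in> context_set n R s"
  obtain i where "c = context_at R s i" using occ_setD[OF ct[unfolded context_set_def]] by blast
  then have "set c \<subseteq> A" "length c = L" using assms by (auto simp: context_at_def)
  moreover have "t < n"
  proof -
    have "t < card {i \<in> {0..<int n}. context_at R s i = c}" using ct by (simp add: context_set_def occ_set_def)
    also have "\<dots> \<le> card {0..<int n}" by (rule card_mono) auto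
    finally show ?thesis by simp
  qed
  ultimately show "(c, t) \<in> context_universe A n L" by (simp add: context_universe_def)
qed

text \<open>Union bound over at most n^2 pairs of positions, whence the bound 1 / (8 n^2) asked of
  each pair.\<close>

lemma prob_context_collision:
  assumes "n > 0" and far: "\<And>x y. \<not> d dvd y - x \<Longrightarrow>
      (1 - cyc_ham (int n) (shift_by x s) (shift_by y s) / n) ^ L \<le> 1 / (8 * real n ^ 2)"
  shows "measure_pmf.prob (pmf_of_set (offset_lists n L))
      {R. \<exists>x\<in>{0..<int n}. \<exists>y\<in>{0..<int n}. context_at R s x = context_at R s y \<and> \<not> d dvd y - x} \<le> 1 / 8"
proof -
  let ?p = "pmf_of_set (offset_lists n L)"
  define P where "P = {(x, y). x \<in> {0..<int n} \<and> y \<in> {0..<int n} \<and> \<not> d dvd y - x}"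
  have P: "P \<subseteq> {0..<int n} \<times> {0..<int n}" by (auto simp: P_def)
  have finP: "finite P" by (rule finite_subset[OF P]) simp
  have cP: "card P \<le> n\<^sup>2" using card_mono[OF _ P] by (simp add: power2_eq_square)
  have "measure_pmf.prob ?p
      {R. \<exists>x\<in>{0..<int n}. \<exists>y\<in>{0..<int n}. context_at R s x = context_at R s y \<and> \<not> d dvd y - x}
    = measure_pmf.prob ?p (\<Union>z\<in>P. {R. context_at R s (fst z) = context_at R s (snd z)})"
    by (rule arg_cong[where f = "measure_pmf.prob ?p"]) (unfold P_def, force)
  also have "\<dots> \<le> (\<Sum>z\<in>P. measure_pmf.prob ?p {R. context_at R s (fst z) = context_at R s (snd z)})"
    by (rule measure_pmf.finite_measure_subadditive_finite) (use finP in auto)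
  also have "\<dots> \<le> (\<Sum>z\<in>P. 1 / (8 * real n ^ 2))"
    unfolding prob_context_eq[OF assms(1)] by (intro sum_mono far) (auto simp: P_def)
  also have "\<dots> = real (card P) * (1 / (8 * real n ^ 2))" by simp
  also have "\<dots> \<le> real (n\<^sup>2) * (1 / (8 * real n ^ 2))"
    using cP by (intro mult_right_mono) (simp_all only: of_nat_le_iff, simp)
  also have "\<dots> = 1 / 8" using assms(1) by simp
  finally show ?thesis .
qed

text \<open>Linearity of expectation over the positions: by Bernoulli's inequality each context hits
  one of the at most k mismatches with probability at most L k / n.\<close>

lemma expectation_context_mismatches:
  assumes "n > 0" "cyc_ham (int n) s\<^sub>1 (shift_by m s\<^sub>2) \<le> k" "8 * k * L \<le> n"
    and per: "periodic (int n) s\<^sub>1" "periodic (int n) s\<^sub>2"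
  shows "measure_pmf.expectation (pmf_of_set (offset_lists n L))
      (\<lambda>R. 2 * card {i \<in> {0..<int n}. context_at R s\<^sub>1 i \<noteq> context_at R s\<^sub>2 (i + m)} / n) \<le> 1 / 4"
proof -
  let ?p = "pmf_of_set (offset_lists n L)"
  let ?E = "\<lambda>i. {R. context_at R s\<^sub>1 i \<noteq> context_at R s\<^sub>2 (i + m)}"
  have fin: "finite (set_pmf ?p)"
    using finite_offset_lists offset_lists_nonempty[OF assms(1)] by (simp add: set_pmf_of_set)
  have E: "measure_pmf.prob ?p (?E i) \<le> real L * k / n" for i
  proof -
    define h where "h = cyc_ham (int n) (shift_by i s\<^sub>1) (shift_by (i + m) s\<^sub>2)"
    have "h = cyc_ham (int n) s\<^sub>1 (shift_by m s\<^sub>2)"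
      unfolding h_def using cyc_ham_shift[OF per(1) periodic_shift[OF per(2)], of i m] assms(1)
      by (simp add: shift_shift)
    then have h: "h \<le> k" using assms(2) by simp
    have hn: "h \<le> n" using cyc_ham_le[of "int n" "shift_by i s\<^sub>1" "shift_by (i + m) s\<^sub>2"] by (simp add: h_def)
    have "measure_pmf.prob ?p (?E i) = 1 - measure_pmf.prob ?p {R. context_at R s\<^sub>1 i = context_at R s\<^sub>2 (i + m)}"
      by (subst measure_pmf.prob_compl[symmetric]) (auto intro!: arg_cong[where f = "measure_pmf.prob ?p"])
    also have "\<dots> = 1 - (1 - real h / n) ^ L" unfolding prob_context_eq[OF assms(1)] h_def ..
    also have "\<dots> \<le> real L * (real h / n)"
      using Bernoulli_inequality[of "- (real h / n)" L] hn assms(1) by simp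
    also have "\<dots> \<le> real L * (real k / n)" using h by (intro mult_left_mono divide_right_mono) auto
    finally show ?thesis by simp
  qed
  have count: "real (card {i \<in> {0..<int n}. context_at R s\<^sub>1 i \<noteq> context_at R s\<^sub>2 (i + m)})
      = (\<Sum>i\<in>{0..<int n}. indicat_real (?E i) R)" for R
  proof -
    have "real (card {i \<in> {0..<int n}. context_at R s\<^sub>1 i \<noteq> context_at R s\<^sub>2 (i + m)})
        = (\<Sum>i\<in>{0..<int n}. if context_at R s\<^sub>1 i \<noteq> context_at R s\<^sub>2 (i + m) then 1 else 0)"
      by (subst sum.inter_filter[symmetric]) simp_all
    also have "\<dots> = (\<Sum>i\<in>{0..<int n}. indicat_real (?E i) R)"
      by (rule sum.cong) (simp_all add: indicator_def)
    finally show ?thesis .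
  qed
  have "measure_pmf.expectation ?p
      (\<lambda>R. 2 * card {i \<in> {0..<int n}. context_at R s\<^sub>1 i \<noteq> context_at R s\<^sub>2 (i + m)} / n)
    = 2 / n * measure_pmf.expectation ?p (\<lambda>R. \<Sum>i\<in>{0..<int n}. indicat_real (?E i) R)"
  proof -
    have "real (2 * card {i \<in> {0..<int n}. context_at R s\<^sub>1 i \<noteq> context_at R s\<^sub>2 (i + m)}) / n
        = 2 / n * (\<Sum>i\<in>{0..<int n}. indicat_real (?E i) R)" for R
      unfolding of_nat_mult count by simp
    then show ?thesis by (simp only: integral_mult_right_zero)
  qed
  also have "measure_pmf.expectation ?p (\<lambda>R. \<Sum>i\<in>{0..<int n}. indicat_real (?E i) R)
      = (\<Sum>i\<in>{0..<int n}. measure_pmf.expectation ?p (indicat_real (?E i)))"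
    by (rule Bochner_Integration.integral_sum) (rule integrable_measure_pmf_finite[OF fin])
  also have "\<dots> = (\<Sum>i\<in>{0..<int n}. measure_pmf.prob ?p (?E i))" by simp
  also have "2 / n * \<dots> \<le> 2 / n * (\<Sum>i\<in>{0..<int n}. real L * k / n)"
    using E by (intro mult_left_mono sum_mono) auto
  also have "\<dots> = 2 * (real L * k / n)" using assms(1) by simp
  also have "\<dots> \<le> 1 / 4"
  proof -
    have "real (8 * k * L) \<le> real n" using assms(3) by (simp only: of_nat_le_iff)
    then show ?thesis using assms(1) by (simp add: field_simps)
  qed
  finally show ?thesis .
qed

text \<open>Three things can go wrong: contexts fail to separate the classes of the first string, or
  of the second, or the first context of the union is not common. They cost 1/8, 1/8 and
  1/4.\<close>

lemma prob_anchors_differ: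
  fixes A :: "'a::countable set"
  assumes A: "finite A" "\<And>x. s\<^sub>1 x \<in> A" "\<And>x. s\<^sub>2 x \<in> A"
    and n: "n > 0" "8 * k * L \<le> n" "d dvd int n"
    and per: "periodic (int n) s\<^sub>1" "periodic (int n) s\<^sub>2" "cyc_ham (int n) s\<^sub>1 (shift_by m s\<^sub>2) \<le> k"
    and far: "\<And>s x y. s \<in> {s\<^sub>1, s\<^sub>2} \<Longrightarrow> \<not> d dvd y - x \<Longrightarrow>
      (1 - cyc_ham (int n) (shift_by x s) (shift_by y s) / n) ^ L \<le> 1 / (8 * real n ^ 2)"
  shows "measure_pmf.prob (anchor_pmf A n L)
      {\<omega>. \<not> d dvd anchor n \<omega> s\<^sub>2 - anchor n \<omega> s\<^sub>1 - m} \<le> 1 / 2"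
proof -
  let ?p = "pmf_of_set (offset_lists n L)" and ?U = "context_universe A n L"
  let ?q = "pmf_of_set {\<pi>. \<pi> permutes ?U}"
  let ?X = "\<lambda>R. context_set n R s\<^sub>1 \<union> context_set n R s\<^sub>2" and ?G = "\<lambda>R. common_contexts n R m s\<^sub>1 s\<^sub>2"
  define D where "D s = {R. \<exists>x\<in>{0..<int n}. \<exists>y\<in>{0..<int n}.
      context_at R s x = context_at R s y \<and> \<not> d dvd y - x}" for s :: "int \<Rightarrow> 'a"
  define E where "E = {(R, \<pi>). \<exists>u\<in>?X R - ?G R. is_first \<pi> (?X R) u}"
  have finU: "finite ?U" unfolding context_universe_def by (intro finite_cartesian_product finite_lists_length_eq A(1)) simp
  have setp: "set_pmf ?p = offset_lists n L"
    by (rule set_pmf_of_set[OF offset_lists_nonempty[OF n(1)] finite_offset_lists])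
  have setq: "set_pmf ?q = {\<pi>. \<pi> permutes ?U}"
    by (rule set_pmf_of_set) (use finite_permutations[OF finU] permutes_id[of ?U] in blast)+
  \<comment> \<open>The inclusion of events is shown on the support only, because elsewhere the
    second component need not be a permutation.\<close>
  have supp: "\<omega> \<in> {\<omega>. fst \<omega> \<in> D s\<^sub>1} \<union> {\<omega>. fst \<omega> \<in> D s\<^sub>2} \<union> E"
    if \<omega>: "\<omega> \<in> set_pmf (anchor_pmf A n L)" "\<not> d dvd anchor n \<omega> s\<^sub>2 - anchor n \<omega> s\<^sub>1 - m" for \<omega>
  proof (rule ccontr)
    assume no: "\<not> ?thesis"
    obtain R \<pi> where R: "\<omega> = (R, \<pi>)" by (cases \<omega>)
    have "\<pi> permutes ?U" using \<omega>(1) setq by (simp add: R anchor_pmf_def)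
    then have inj: "inj \<pi>" by (rule permutes_inj)
    have "card (context_set n R s\<^sub>1) = n" unfolding context_set_def by (subst card_occ_set) auto
    then have "?X R \<noteq> {}" using n(1) by auto
    then obtain u where u: "is_first \<pi> (?X R) u" using ex_is_first by blast
    then have "u \<in> ?G R" using no unfolding E_def R is_first_def by blast
    then have "d dvd anchor n (R, \<pi>) s\<^sub>2 - anchor n (R, \<pi>) s\<^sub>1 - m"
      using no unfolding D_def R by (intro anchor_shift[OF per(2) n(1,3) inj _ _ _ u]) auto
    then show False using \<omega>(2) R by simp
  qed
  have "measure_pmf.prob (anchor_pmf A n L) {\<omega>. \<not> d dvd anchor n \<omega> s\<^sub>2 - anchor n \<omega> s\<^sub>1 - m}
      \<le> measure_pmf.prob (anchor_pmf A n L) ({\<omega>. fst \<omega> \<in> D s\<^sub>1} \<union> {\<omega>. fst \<omega> \<in> D s\<^sub>2} \<union> E)"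
    by (rule measure_pmf.finite_measure_mono_AE) (use supp in \<open>simp_all add: AE_measure_pmf_iff\<close>)
  also have "\<dots> \<le> measure_pmf.prob (anchor_pmf A n L) {\<omega>. fst \<omega> \<in> D s\<^sub>1}
      + measure_pmf.prob (anchor_pmf A n L) {\<omega>. fst \<omega> \<in> D s\<^sub>2}
      + measure_pmf.prob (anchor_pmf A n L) E"
    by (intro order_trans[OF measure_Un_le] add_mono measure_Un_le order_refl) auto
  also have "\<dots> \<le> 1 / 8 + 1 / 8 + 1 / 4"
  proof (intro add_mono)
    show "measure_pmf.prob (anchor_pmf A n L) {\<omega>. fst \<omega> \<in> D s\<^sub>1} \<le> 1 / 8"
      unfolding anchor_pmf_def prob_pair_pmf_fst D_def
      by (rule prob_context_collision[OF n(1) far]) auto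
    show "measure_pmf.prob (anchor_pmf A n L) {\<omega>. fst \<omega> \<in> D s\<^sub>2} \<le> 1 / 8"
      unfolding anchor_pmf_def prob_pair_pmf_fst D_def
      by (rule prob_context_collision[OF n(1) far]) auto
    have "measure_pmf.prob (anchor_pmf A n L) E \<le> measure_pmf.expectation ?p
      (\<lambda>R. 2 * card {i \<in> {0..<int n}. context_at R s\<^sub>1 i \<noteq> context_at R s\<^sub>2 (i + m)} / n)"
      unfolding anchor_pmf_def
    proof (rule prob_pair_pmf_le_expectation)
      show "integrable (measure_pmf ?p)
          (\<lambda>R. real (2 * card {i \<in> {0..<int n}. context_at R s\<^sub>1 i \<noteq> context_at R s\<^sub>2 (i + m)}) / n)"
        by (rule integrable_measure_pmf_finite) (simp add: setp finite_offset_lists)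
      fix R assume "R \<in> set_pmf ?p"
      then have "length R = L" unfolding setp by (simp add: offset_lists_def)
      then have "?X R \<subseteq> ?U" by (intro Un_least context_set_subset_universe A)
      then have "measure_pmf.prob ?q {\<pi>. \<exists>u\<in>?X R - ?G R. is_first \<pi> (?X R) u}
          \<le> card (?X R - ?G R) / card (?X R)"
        by (intro prob_first_in[OF finU]) auto
      also have "\<dots> \<le> 2 * card {i \<in> {0..<int n}. context_at R s\<^sub>1 i \<noteq> context_at R s\<^sub>2 (i + m)} / n"
        by (rule card_context_sets_minus_common[OF per(2) n(1)])
      finally show "measure_pmf.prob ?q {\<pi>. (R, \<pi>) \<in> E}
          \<le> 2 * card {i \<in> {0..<int n}. context_at R s\<^sub>1 i \<noteq> context_at R s\<^sub>2 (i + m)} / n"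
        by (simp add: E_def)
    qed
    also have "\<dots> \<le> 1 / 4" by (rule expectation_context_mismatches[OF n(1) per(3) n(2) per(1,2)])
    finally show "measure_pmf.prob (anchor_pmf A n L) E \<le> 1 / 4" .
  qed
  finally show ?thesis by simp
qed

section \<open>The sketch and its decoder\<close>

text \<open>Rounding n / (8 k) down to L loses at most a factor of 2, so L h / n is at least 2 l +
  3. The power is then at most exp (- (2 l + 3)), which is at most 2 ^ - (2 l + 3), and 2 ^ (2 l) is
  at least n^2.\<close>

lemma context_collision_bound:
  fixes n k l h :: nat
  assumes "n > 0" "k > 0" "n < 2 ^ l" "16 * k * (2 * l + 3) < h" "h \<le> n"
  shows "(1 - real h / n) ^ (n div (8 * k)) \<le> 1 / (8 * real n ^ 2)"
proof -
  define L where "L = n div (8 * k)"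
  have "16 * k \<le> 16 * k * (2 * l + 3)" by simp
  then have "8 * k \<le> n" using assms by linarith
  then have "L \<ge> 1" using assms(2) by (simp add: L_def div_greater_zero_iff Suc_le_eq)
  have "n = 8 * k * L + n mod (8 * k)" unfolding L_def by simp
  moreover have "n mod (8 * k) < 8 * k" using assms(2) by simp
  moreover have "8 * k \<le> 8 * k * L" using \<open>L \<ge> 1\<close> by simp
  ultimately have nL: "n \<le> 16 * k * L" by linarith
  have "(2 * l + 3) * n \<le> (2 * l + 3) * (16 * k * L)" using nL by (intro mult_left_mono) auto
  also have "\<dots> = (16 * k * (2 * l + 3)) * L" by (simp add: algebra_simps)
  also have "\<dots> \<le> h * L" using assms(4) by (intro mult_right_mono) auto
  finally have "real ((2 * l + 3) * n) \<le> real (h * L)" by (simp only: of_nat_le_iff)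
  then have hL: "real (2 * l + 3) \<le> real L * (real h / n)" using assms(1) by (simp add: field_simps)
  have "1 - real h / n \<le> exp (- (real h / n))" using exp_ge_add_one_self[of "- (real h / n)"] by simp
  then have "(1 - real h / n) ^ L \<le> exp (- (real h / n)) ^ L"
    using assms(1,5) by (intro power_mono) auto
  also have "\<dots> = exp (- (real L * (real h / n)))" by (simp add: exp_of_nat_mult[symmetric])
  also have "\<dots> \<le> exp (- real (2 * l + 3))" using hL by simp
  also have "\<dots> = 1 / exp 1 ^ (2 * l + 3)"
    by (simp only: exp_minus inverse_eq_divide exp_of_nat_mult[symmetric] mult_1_right)
  also have "\<dots> \<le> 1 / 2 ^ (2 * l + 3)"
    using exp_ge_add_one_self[of 1] by (intro divide_left_mono power_mono) auto
  also have "\<dots> = 1 / (8 * (2 ^ l) ^ 2)" by (simp add: power_add power_mult power2_eq_square algebra_simps power_mult_distrib)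
  also have "\<dots> \<le> 1 / (8 * real n ^ 2)"
  proof -
    have "real n \<le> 2 ^ l" using assms(3) by (metis less_imp_le of_nat_le_iff of_nat_numeral of_nat_power)
    then have "real n ^ 2 \<le> (2 ^ l) ^ 2" by (intro power_mono) auto
    then show ?thesis using assms(1) by (intro divide_left_mono) auto
  qed
  finally show ?thesis by (simp add: L_def)
qed

locale circular_sketch =
  fixes n k l :: nat
  assumes n_pos: "n > 0" and k_pos: "k > 0" and n_less: "n < 2 ^ l"
begin

text \<open>A hash range above 8 n^3, so that 2n letters collide with probability at most 1 /
  (2n).\<close>

definition q :: nat where "q = 2 ^ (7 * l)"
text \<open>The base threshold is the one demanded by \<open>context_collision_bound\<close>; steps
  of 2k make the divisor chains of two close strings interlace.\<close>

definition level :: "nat \<Rightarrow> nat" where "level j = 16 * k * (2 * l + 3) + 2 * k * j"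
text \<open>Odd, and larger than 4n times the bound on the number of candidate mismatch sets in
  \<open>ambiguity_count_le\<close>.\<close>

definition N :: int where "N = 2 ^ (20 * l * k) + 1"
definition symbols :: "nat option set" where "symbols = insert None (Some ` {..<q})"

definition inputs :: "(int \<Rightarrow> nat) set" where
  "inputs = {s. periodic (int n) s \<and> (\<forall>x. s x < q)}"

definition level_gcd :: "nat \<Rightarrow> (int \<Rightarrow> nat) \<Rightarrow> int" where
  "level_gcd j s = near_gcd (int n) (level j) s"

text \<open>For close strings each trial fails with probability at most 1/2 at a level where the
  gcds coincide, and 2 ^ (l + 2) is at least 4n.\<close>

definition anchors_pmf :: "(nat \<Rightarrow> int list \<times> (nat list \<times> nat \<Rightarrow> nat list \<times> nat)) pmf" where
  "anchors_pmf = Pi_pmf {..<l + 2} undefined (\<lambda>_. anchor_pmf {..<q} n (n div (8 * k)))"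

definition weights_pmf :: "(int \<times> nat option \<Rightarrow> int) pmf" where
  "weights_pmf = pmf_of_set (({0..<int n} \<times> symbols) \<rightarrow>\<^sub>E {0..<N})"

text \<open>Both tables are extensional functions, so that their possible values can be counted as
  elements of finite products.\<close>

definition data where
  "data \<omega> s = (\<lambda>j\<in>{..<2 * l}. ((level_gcd j s, special_part (level_gcd j s) s),
     \<lambda>\<tau>\<in>{..<l + 2}. (anchor n (fst \<omega> \<tau>) s,
       lin_sketch (snd \<omega>) (level_gcd j s) (anchor n (fst \<omega> \<tau>) s) (regular_part (level_gcd j s) s) mod N)))"

text \<open>Whether two anchors correspond under the rotation can be tested from the sketches alone.
  Any pair that passes is safe to use, also when the strings are far apart.\<close>

definition aligned where
  "aligned D\<^sub>1 D\<^sub>2 m = {(j, \<tau>). j < 2 * l \<and> \<tau> < l + 2 \<and> fst (fst (D\<^sub>1 j)) = fst (fst (D\<^sub>2 j)) \<and>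
     fst (fst (D\<^sub>1 j)) dvd fst (snd (D\<^sub>2 j) \<tau>) - fst (snd (D\<^sub>1 j) \<tau>) - m}"

text \<open>The decoder does not reconstruct the inputs: any pair of strings consistent with the two
  sketches has the same Hamming distance.\<close>
definition candidate where
  "candidate r d e\<^sub>1 e\<^sub>2 a\<^sub>1 a\<^sub>2 z s\<^sub>1 s\<^sub>2 \<longleftrightarrow> s\<^sub>1 \<in> inputs \<and> s\<^sub>2 \<in> inputs \<and>
     special_part d s\<^sub>1 = e\<^sub>1 \<and> special_part d s\<^sub>2 = e\<^sub>2 \<and>
     card (mismatches d a\<^sub>1 a\<^sub>2 (regular_part d s\<^sub>1) (regular_part d s\<^sub>2)) \<le> k \<and>
     N dvd z - diff_sum r (mismatches d a\<^sub>1 a\<^sub>2 (regular_part d s\<^sub>1) (regular_part d s\<^sub>2))"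

definition decode_at where
  "decode_at r d e\<^sub>1 e\<^sub>2 a\<^sub>1 a\<^sub>2 z m =
     (if \<exists>p. candidate r d e\<^sub>1 e\<^sub>2 a\<^sub>1 a\<^sub>2 z (fst p) (snd p)
      then let p = SOME p. candidate r d e\<^sub>1 e\<^sub>2 a\<^sub>1 a\<^sub>2 z (fst p) (snd p)
           in cyc_ham (int n) (fst p) (shift_by m (snd p))
      else k + 1)"

text \<open>The default k + 1 is right for distant strings; close strings lack an aligned pair only
  with small probability.\<close>

definition decode where
  "decode r D\<^sub>1 D\<^sub>2 m =
     (if aligned D\<^sub>1 D\<^sub>2 m = {} then k + 1
      else let (j, \<tau>) = SOME p. p \<in> aligned D\<^sub>1 D\<^sub>2 m
           in decode_at r (fst (fst (D\<^sub>1 j))) (snd (fst (D\<^sub>1 j))) (snd (fst (D\<^sub>2 j)))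
                (fst (snd (D\<^sub>1 j) \<tau>)) (fst (snd (D\<^sub>2 j) \<tau>))
                (snd (snd (D\<^sub>1 j) \<tau>) - snd (snd (D\<^sub>2 j) \<tau>)) m)"

definition correct :: "nat \<Rightarrow> nat \<Rightarrow> bool" where
  "correct h v \<longleftrightarrow> (if h \<le> k then v = h else v > k)"

text \<open>W itself may have more than k elements; non-ambiguity then says that no small set can be
  mistaken for it.\<close>

definition ambiguous where
  "ambiguous r W \<longleftrightarrow> (\<exists>W'\<subseteq>{0..<int n} \<times> symbols \<times> symbols. mismatch_set W' \<and> card W' \<le> k \<and>
     W' \<noteq> W \<and> N dvd diff_sum r W - diff_sum r W')"

section \<open>Correctness of the decoder\<close>

lemma l_pos: "l > 0"
  using n_pos n_less by (cases l) auto

lemma N_pos: "N > 0" and N_odd: "odd N"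
  using l_pos k_pos by (auto simp: N_def)

lemma finite_symbols: "finite symbols" and card_symbols: "card symbols = q + 1"
  by (simp_all add: symbols_def card_image)

lemma regular_part_in_symbols: "s \<in> inputs \<Longrightarrow> regular_part d s x \<in> symbols"
  by (simp add: regular_part_def symbols_def inputs_def)

lemma level_gcd_pos: "level_gcd j s > 0" and level_gcd_dvd: "level_gcd j s dvd int n" and level_gcd_le: "level_gcd j s \<le> int n"
proof -
  show "level_gcd j s > 0" unfolding level_gcd_def by (rule near_gcd_pos) (use n_pos in simp)
  show dvd: "level_gcd j s dvd int n" unfolding level_gcd_def by (rule near_gcd_dvd)
  show "level_gcd j s \<le> int n" using zdvd_imp_le[OF dvd] n_pos by simp
qed

lemma mismatches_subset:
  assumes "s\<^sub>1 \<in> inputs" "s\<^sub>2 \<in> inputs" "d \<le> int n"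
  shows "mismatches d a\<^sub>1 a\<^sub>2 (regular_part d s\<^sub>1) (regular_part d s\<^sub>2) \<subseteq> {0..<int n} \<times> symbols \<times> symbols"
proof
  fix w assume w: "w \<in> mismatches d a\<^sub>1 a\<^sub>2 (regular_part d s\<^sub>1) (regular_part d s\<^sub>2)"
  obtain x u v where xuv: "w = (x, u, v)" by (cases w)
  show "w \<in> {0..<int n} \<times> symbols \<times> symbols"
    using w unfolding xuv mismatches_iff using regular_part_in_symbols[OF assms(1)] regular_part_in_symbols[OF assms(2)] assms(3)
    by simp
qed

text \<open>Without ambiguity every candidate has the true mismatch set, hence the true Hamming
  distance, whichever candidate \<open>SOME\<close> picks.\<close>

lemma decode_at_correct:
  assumes s: "s\<^sub>1 \<in> inputs" "s\<^sub>2 \<in> inputs"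
    and d: "d > 0" "d dvd int n" "d \<le> int n" "d dvd a\<^sub>2 - a\<^sub>1 - m"
    and z: "N dvd z - diff_sum r (mismatches d a\<^sub>1 a\<^sub>2 (regular_part d s\<^sub>1) (regular_part d s\<^sub>2))"
    and amb: "\<not> ambiguous r (mismatches d a\<^sub>1 a\<^sub>2 (regular_part d s\<^sub>1) (regular_part d s\<^sub>2))"
  shows "correct (cyc_ham (int n) s\<^sub>1 (shift_by m s\<^sub>2))
           (decode_at r d (special_part d s\<^sub>1) (special_part d s\<^sub>2) a\<^sub>1 a\<^sub>2 z m)"
proof -
  let ?W = "\<lambda>s\<^sub>1 s\<^sub>2. mismatches d a\<^sub>1 a\<^sub>2 (regular_part d s\<^sub>1) (regular_part d s\<^sub>2)"
  let ?c = "candidate r d (special_part d s\<^sub>1) (special_part d s\<^sub>2) a\<^sub>1 a\<^sub>2 z"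
  let ?h = "cyc_ham (int n) s\<^sub>1 (shift_by m s\<^sub>2)"
  have same_W: "?W t\<^sub>1 t\<^sub>2 = ?W s\<^sub>1 s\<^sub>2" if c: "?c t\<^sub>1 t\<^sub>2" for t\<^sub>1 t\<^sub>2
  proof (rule ccontr)
    assume ne: "?W t\<^sub>1 t\<^sub>2 \<noteq> ?W s\<^sub>1 s\<^sub>2"
    have t: "t\<^sub>1 \<in> inputs" "t\<^sub>2 \<in> inputs" "card (?W t\<^sub>1 t\<^sub>2) \<le> k" "N dvd z - diff_sum r (?W t\<^sub>1 t\<^sub>2)"
      using c unfolding candidate_def by auto
    have "N dvd (z - diff_sum r (?W t\<^sub>1 t\<^sub>2)) - (z - diff_sum r (?W s\<^sub>1 s\<^sub>2))" by (rule dvd_diff[OF t(4) z])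
    then have "N dvd diff_sum r (?W s\<^sub>1 s\<^sub>2) - diff_sum r (?W t\<^sub>1 t\<^sub>2)" by simp
    moreover have "mismatch_set (?W t\<^sub>1 t\<^sub>2)" by (rule mismatch_set_mismatches)
    moreover note mismatches_subset[OF t(1,2) d(3), of a\<^sub>1 a\<^sub>2]
    ultimately have "ambiguous r (?W s\<^sub>1 s\<^sub>2)" using ne t(3) unfolding ambiguous_def by blast
    then show False using amb by simp
  qed
  have same_ham: "cyc_ham (int n) t\<^sub>1 (shift_by m t\<^sub>2) = ?h" if c: "?c t\<^sub>1 t\<^sub>2" for t\<^sub>1 t\<^sub>2
  proof -
    have "special_part d s\<^sub>1 = special_part d t\<^sub>1" "special_part d s\<^sub>2 = special_part d t\<^sub>2"
      using c unfolding candidate_def by auto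
    from mismatches_determine_mismatch[OF d(1,4) this same_W[OF c, symmetric]]
    show ?thesis unfolding cyc_ham_def shift_by_def by simp
  qed
  have W_le: "card (?W s\<^sub>1 s\<^sub>2) \<le> ?h"
    by (rule card_mismatches_le) (use s d n_pos in \<open>auto simp: inputs_def\<close>)
  show ?thesis
  proof (cases "\<exists>p. ?c (fst p) (snd p)")
    case True
    define p where "p = (SOME p. ?c (fst p) (snd p))"
    have "?c (fst p) (snd p)" unfolding p_def by (rule someI_ex[OF True])
    then have "decode_at r d (special_part d s\<^sub>1) (special_part d s\<^sub>2) a\<^sub>1 a\<^sub>2 z m = ?h"
      unfolding decode_at_def Let_def p_def[symmetric] using True same_ham by auto
    then show ?thesis by (simp add: correct_def)
  next
    case False
    \<comment> \<open>At distance at most k the true pair would itself be a candidate, because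
      regular mismatches are no more numerous than mismatches.\<close>
    have "\<not> ?h \<le> k"
    proof
      assume "?h \<le> k"
      then have "?c s\<^sub>1 s\<^sub>2" using s z W_le unfolding candidate_def by simp
      then show False using False by (metis fst_conv snd_conv)
    qed
    moreover have "decode_at r d (special_part d s\<^sub>1) (special_part d s\<^sub>2) a\<^sub>1 a\<^sub>2 z m = k + 1"
      unfolding decode_at_def by (rule if_not_P[OF False])
    ultimately show ?thesis by (simp add: correct_def)
  qed
qed

text \<open>The pairs that the decoder regards as aligned do not depend on the weights \<open>r\<close>; hence the
  mismatch set it has to recover is independent of them.\<close>
definition chosen where
  "chosen as s\<^sub>1 s\<^sub>2 m = {(j, \<tau>). j < 2 * l \<and> \<tau> < l + 2 \<and> level_gcd j s\<^sub>1 = level_gcd j s\<^sub>2 \<and>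
     level_gcd j s\<^sub>1 dvd anchor n (as \<tau>) s\<^sub>2 - anchor n (as \<tau>) s\<^sub>1 - m}"

definition chosen_mismatches where
  "chosen_mismatches as s\<^sub>1 s\<^sub>2 m =
     (let (j, \<tau>) = SOME p. p \<in> chosen as s\<^sub>1 s\<^sub>2 m; d = level_gcd j s\<^sub>1
      in mismatches d (anchor n (as \<tau>) s\<^sub>1) (anchor n (as \<tau>) s\<^sub>2) (regular_part d s\<^sub>1) (regular_part d s\<^sub>2))"

lemma aligned_data: "aligned (data (as, r) s\<^sub>1) (data (as, r) s\<^sub>2) m = chosen as s\<^sub>1 s\<^sub>2 m"
  unfolding aligned_def chosen_def data_def by auto

lemma decode_correct:
  assumes s: "s\<^sub>1 \<in> inputs" "s\<^sub>2 \<in> inputs"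
    and ch: "chosen as s\<^sub>1 s\<^sub>2 m \<noteq> {} \<or> cyc_ham (int n) s\<^sub>1 (shift_by m s\<^sub>2) > k"
    and amb: "\<not> ambiguous r (chosen_mismatches as s\<^sub>1 s\<^sub>2 m)"
  shows "correct (cyc_ham (int n) s\<^sub>1 (shift_by m s\<^sub>2)) (decode r (data (as, r) s\<^sub>1) (data (as, r) s\<^sub>2) m)"
proof (cases "chosen as s\<^sub>1 s\<^sub>2 m = {}")
  case True
  then show ?thesis using ch by (simp add: decode_def aligned_data correct_def)
next
  case False
  obtain j \<tau> where p: "(SOME p. p \<in> chosen as s\<^sub>1 s\<^sub>2 m) = (j, \<tau>)" by (cases "SOME p. p \<in> chosen as s\<^sub>1 s\<^sub>2 m")
  have "(j, \<tau>) \<in> chosen as s\<^sub>1 s\<^sub>2 m" using some_in_eq[of "chosen as s\<^sub>1 s\<^sub>2 m"] False p by simp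
  then have j: "j < 2 * l" "\<tau> < l + 2" "level_gcd j s\<^sub>2 = level_gcd j s\<^sub>1"
    "level_gcd j s\<^sub>1 dvd anchor n (as \<tau>) s\<^sub>2 - anchor n (as \<tau>) s\<^sub>1 - m"
    by (auto simp: chosen_def)
  let ?d = "level_gcd j s\<^sub>1" and ?a1 = "anchor n (as \<tau>) s\<^sub>1" and ?a2 = "anchor n (as \<tau>) s\<^sub>2"
  let ?z1 = "lin_sketch r ?d ?a1 (regular_part ?d s\<^sub>1)" and ?z2 = "lin_sketch r ?d ?a2 (regular_part ?d s\<^sub>2)"
  let ?W = "mismatches ?d ?a1 ?a2 (regular_part ?d s\<^sub>1) (regular_part ?d s\<^sub>2)"
  have W: "chosen_mismatches as s\<^sub>1 s\<^sub>2 m = ?W" by (simp add: chosen_mismatches_def p Let_def)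
  have dec: "decode r (data (as, r) s\<^sub>1) (data (as, r) s\<^sub>2) m
      = decode_at r ?d (special_part ?d s\<^sub>1) (special_part ?d s\<^sub>2) ?a1 ?a2 (?z1 mod N - ?z2 mod N) m"
  proof -
    have "fst (fst (data (as, r) s j)) = level_gcd j s" "snd (fst (data (as, r) s j)) = special_part (level_gcd j s) s"
      "snd (data (as, r) s j) \<tau> = (anchor n (as \<tau>) s,
         lin_sketch r (level_gcd j s) (anchor n (as \<tau>) s) (regular_part (level_gcd j s) s) mod N)" for s
      using j(1,2) by (simp_all add: data_def)
    note D = this
    show ?thesis unfolding decode_def aligned_data p prod.case Let_def D j(3) using False by simp
  qed
  have "N dvd (?z1 mod N - ?z1) - (?z2 mod N - ?z2)"
    by (rule dvd_diff) (simp_all add: mod_eq_dvd_iff[symmetric])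
  then have "N dvd (?z1 mod N - ?z2 mod N) - (?z1 - ?z2)" by (simp add: algebra_simps)
  then have z: "N dvd (?z1 mod N - ?z2 mod N) - diff_sum r ?W" by (simp only: lin_sketch_diff)
  show ?thesis unfolding dec
    by (rule decode_at_correct[OF s level_gcd_pos level_gcd_dvd level_gcd_le j(4) z]) (use amb W in simp)
qed

section \<open>Error probability and size\<close>

lemma four_n_le: "4 * n \<le> 2 ^ (l + 2)"
  using n_less by (simp add: power_add)

text \<open>At some level both strings have the same gcd, and this level depends on the strings
  alone. There each trial aligns the anchors with probability at least 1/2, independently of the
  others.\<close>

lemma prob_chosen_empty:
  assumes s: "s\<^sub>1 \<in> inputs" "s\<^sub>2 \<in> inputs" and h: "cyc_ham (int n) s\<^sub>1 (shift_by m s\<^sub>2) \<le> k"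
  shows "measure_pmf.prob anchors_pmf {as. chosen as s\<^sub>1 s\<^sub>2 m = {}} \<le> 1 / (4 * real n)"
proof -
  let ?L = "n div (8 * k)"
  have per: "periodic (int n) s\<^sub>1" "periodic (int n) s\<^sub>2" using s by (auto simp: inputs_def)
  have "int n < 2 ^ l" using n_less by simp
  then obtain j where j: "j < 2 * l" "level_gcd j s\<^sub>1 = level_gcd j s\<^sub>2"
    using common_near_gcd_level[OF per _ _ h, of l "16 * k * (2 * l + 3)"] n_pos
    unfolding level_gcd_def level_def by auto
  define d where "d = level_gcd j s\<^sub>1"
  define B where "B = {\<omega>. \<not> d dvd anchor n \<omega> s\<^sub>2 - anchor n \<omega> s\<^sub>1 - m}"
  have far: "(1 - cyc_ham (int n) (shift_by x s) (shift_by y s) / n) ^ ?L \<le> 1 / (8 * real n ^ 2)"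
    if "s \<in> {s\<^sub>1, s\<^sub>2}" "\<not> d dvd y - x" for s x y
  proof (rule context_collision_bound[OF n_pos k_pos n_less])
    have "d = near_gcd (int n) (level j) s" using that(1) j(2) by (auto simp: d_def level_gcd_def)
    moreover have "periodic (int n) s" using that(1) per by auto
    ultimately have "\<not> cyc_ham (int n) (shift_by x s) (shift_by y s) \<le> level j"
      using near_gcd_dvd_diff[of "int n" s x y "level j"] that(2) n_pos by auto
    then show "16 * k * (2 * l + 3) < cyc_ham (int n) (shift_by x s) (shift_by y s)"
      by (simp add: level_def)
    show "cyc_ham (int n) (shift_by x s) (shift_by y s) \<le> n"
      using cyc_ham_le[of "int n" "shift_by x s" "shift_by y s"] by simp
  qed
  have half: "measure_pmf.prob (anchor_pmf {..<q} n ?L) B \<le> 1 / 2"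
    unfolding B_def
  proof (rule prob_anchors_differ[OF _ _ _ n_pos _ _ per h far])
    show "8 * k * ?L \<le> n" by simp
    show "d dvd int n" unfolding d_def by (rule level_gcd_dvd)
  qed (use s in \<open>auto simp: inputs_def\<close>)
  \<comment> \<open>Only the trials at the common level j are counted; aligned pairs at other levels
    can only help.\<close>
  have "measure_pmf.prob anchors_pmf {as. chosen as s\<^sub>1 s\<^sub>2 m = {}}
      \<le> measure_pmf.prob anchors_pmf (Pi {..<l + 2} (\<lambda>_. B))"
    by (rule measure_pmf.finite_measure_mono) (use j in \<open>auto simp: chosen_def B_def d_def\<close>)
  also have "\<dots> = (\<Prod>\<tau>\<in>{..<l + 2}. measure_pmf.prob (anchor_pmf {..<q} n ?L) B)"
    unfolding anchors_pmf_def by (rule measure_Pi_pmf_Pi) simp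
  also have "\<dots> = measure_pmf.prob (anchor_pmf {..<q} n ?L) B ^ (l + 2)" by simp
  also have "\<dots> \<le> (1 / 2) ^ (l + 2)" by (rule power_mono[OF half]) simp
  also have "\<dots> = 1 / real (2 ^ (l + 2))" by (simp add: power_divide)
  also have "\<dots> \<le> 1 / real (4 * n)"
    using four_n_le n_pos by (intro divide_left_mono) (simp_all only: of_nat_le_iff, simp_all)
  finally show ?thesis by simp
qed

text \<open>The exponent of N: a mismatch triple takes at most l + 8 l + 8 l = 17 l bits, and the
  factor 4n takes l + 2 <= 3 l k more.\<close>

lemma ambiguity_count_le: "4 * n * (n * (q + 1) * (q + 1) + 1) ^ k \<le> 2 ^ (20 * l * k)"
proof -
  have l: "l \<ge> 1" and k: "k \<ge> 1" using l_pos k_pos by auto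
  have "q + 1 \<le> 2 ^ (7 * l) + 2 ^ (7 * l)" by (simp add: q_def)
  also have "\<dots> = 2 ^ (7 * l + 1)" by simp
  also have "\<dots> \<le> 2 ^ (8 * l)" using l by (intro power_increasing) auto
  finally have q1: "q + 1 \<le> 2 ^ (8 * l)" .
  have "n * (q + 1) * (q + 1) + 1 \<le> (n + 1) * (q + 1) * (q + 1)" by (simp add: algebra_simps)
  also have "\<dots> \<le> 2 ^ l * 2 ^ (8 * l) * 2 ^ (8 * l)"
    using q1 n_less by (intro mult_mono) auto
  also have "\<dots> = 2 ^ (17 * l)" by (simp flip: power_add)
  finally have "(n * (q + 1) * (q + 1) + 1) ^ k \<le> (2 ^ (17 * l)) ^ k" by (rule power_mono) simp
  then have "4 * n * (n * (q + 1) * (q + 1) + 1) ^ k \<le> 2 ^ (l + 2) * (2 ^ (17 * l)) ^ k"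
    using four_n_le by (intro mult_mono) auto
  also have "\<dots> = 2 ^ (l + 2 + 17 * l * k)" by (simp only: power_add power_mult)
  also have "\<dots> \<le> 2 ^ (20 * l * k)"
  proof (rule power_increasing)
    have "l + 2 \<le> 3 * l" using l by simp
    also have "\<dots> \<le> 3 * l * k" using k by simp
    finally show "l + 2 + 17 * l * k \<le> 20 * l * k" by linarith
  qed simp
  finally show ?thesis .
qed

lemma prob_ambiguous:
  assumes "mismatch_set W" "W \<subseteq> {0..<int n} \<times> symbols \<times> symbols"
  shows "measure_pmf.prob weights_pmf {r. ambiguous r W} \<le> 1 / (4 * real n)"
proof -
  have "measure_pmf.prob weights_pmf {r. ambiguous r W}
      \<le> real ((card {0..<int n} * card symbols * card symbols + 1) ^ k) / real_of_int N"
    unfolding weights_pmf_def ambiguous_def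
    by (rule prob_sketch_ambiguous[OF _ finite_symbols N_pos N_odd assms]) simp
  also have "\<dots> = real ((n * (q + 1) * (q + 1) + 1) ^ k) / real_of_int N" by (simp add: card_symbols)
  also have "\<dots> \<le> 1 / (4 * real n)"
  proof -
    have "real (4 * n * (n * (q + 1) * (q + 1) + 1) ^ k) \<le> real (2 ^ (20 * l * k))"
      using ambiguity_count_le by (simp only: of_nat_le_iff)
    also have "\<dots> \<le> real_of_int N" by (simp add: N_def)
    finally have "4 * real n * real ((n * (q + 1) * (q + 1) + 1) ^ k) \<le> real_of_int N"
      by (simp only: of_nat_mult of_nat_numeral)
    then show ?thesis using N_pos n_pos by (simp only: divide_le_eq le_divide_eq) (simp add: field_simps)
  qed
  finally show ?thesis .
qed

lemma chosen_mismatches_valid: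
  assumes "s\<^sub>1 \<in> inputs" "s\<^sub>2 \<in> inputs"
  shows "mismatch_set (chosen_mismatches as s\<^sub>1 s\<^sub>2 m)"
    and "chosen_mismatches as s\<^sub>1 s\<^sub>2 m \<subseteq> {0..<int n} \<times> symbols \<times> symbols"
proof -
  \<comment> \<open>If \<open>chosen\<close> is empty the pair is arbitrary; both claims hold for
    every pair.\<close>
  obtain j \<tau> where "(SOME p. p \<in> chosen as s\<^sub>1 s\<^sub>2 m) = (j, \<tau>)" by (cases "SOME p. p \<in> chosen as s\<^sub>1 s\<^sub>2 m")
  then have W: "chosen_mismatches as s\<^sub>1 s\<^sub>2 m = mismatches (level_gcd j s\<^sub>1) (anchor n (as \<tau>) s\<^sub>1)
      (anchor n (as \<tau>) s\<^sub>2) (regular_part (level_gcd j s\<^sub>1) s\<^sub>1) (regular_part (level_gcd j s\<^sub>1) s\<^sub>2)"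
    by (simp add: chosen_mismatches_def Let_def)
  show "mismatch_set (chosen_mismatches as s\<^sub>1 s\<^sub>2 m)"
    unfolding W by (rule mismatch_set_mismatches)
  show "chosen_mismatches as s\<^sub>1 s\<^sub>2 m \<subseteq> {0..<int n} \<times> symbols \<times> symbols"
    unfolding W by (rule mismatches_subset[OF assms level_gcd_le])
qed

lemma prob_incorrect:
  assumes s: "s\<^sub>1 \<in> inputs" "s\<^sub>2 \<in> inputs"
  shows "measure_pmf.prob (pair_pmf anchors_pmf weights_pmf)
      {\<omega>. \<not> correct (cyc_ham (int n) s\<^sub>1 (shift_by m s\<^sub>2)) (decode (snd \<omega>) (data \<omega> s\<^sub>1) (data \<omega> s\<^sub>2) m)}
    \<le> 1 / (2 * real n)"
proof -
  let ?P = "measure_pmf.prob (pair_pmf anchors_pmf weights_pmf)" and ?h = "cyc_ham (int n) s\<^sub>1 (shift_by m s\<^sub>2)"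
  define E1 where "E1 = {as. chosen as s\<^sub>1 s\<^sub>2 m = {} \<and> ?h \<le> k}"
  define E2 where "E2 = {\<omega>. ambiguous (snd \<omega>) (chosen_mismatches (fst \<omega>) s\<^sub>1 s\<^sub>2 m)}"
  have "?P {\<omega>. \<not> correct ?h (decode (snd \<omega>) (data \<omega> s\<^sub>1) (data \<omega> s\<^sub>2) m)} \<le> ?P ({\<omega>. fst \<omega> \<in> E1} \<union> E2)"
  proof (rule measure_pmf.finite_measure_mono)
    show "{\<omega>. \<not> correct ?h (decode (snd \<omega>) (data \<omega> s\<^sub>1) (data \<omega> s\<^sub>2) m)} \<subseteq> {\<omega>. fst \<omega> \<in> E1} \<union> E2"
    proof
      fix \<omega> assume w: "\<omega> \<in> {\<omega>. \<not> correct ?h (decode (snd \<omega>) (data \<omega> s\<^sub>1) (data \<omega> s\<^sub>2) m)}"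
      obtain as r where wr: "\<omega> = (as, r)" by (cases \<omega>)
      show "\<omega> \<in> {\<omega>. fst \<omega> \<in> E1} \<union> E2"
        using w decode_correct[OF s, of as m r] unfolding wr E1_def E2_def by fastforce
    qed
  qed simp
  also have "\<dots> \<le> ?P {\<omega>. fst \<omega> \<in> E1} + ?P E2" by (rule measure_Un_le) auto
  also have "\<dots> \<le> 1 / (4 * real n) + 1 / (4 * real n)"
  proof (rule add_mono)
    show "?P {\<omega>. fst \<omega> \<in> E1} \<le> 1 / (4 * real n)"
    proof (cases "?h \<le> k")
      case True
      then have "E1 = {as. chosen as s\<^sub>1 s\<^sub>2 m = {}}" by (simp add: E1_def)
      then show ?thesis using prob_chosen_empty[OF s True] by (simp only: prob_pair_pmf_fst)
    qed (simp add: E1_def)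
    show "?P E2 \<le> 1 / (4 * real n)"
    \<comment> \<open>The anchors are fixed first. They determine the mismatch set to be recovered,
      and the weights are independent of it.\<close>
    proof (rule prob_pair_pmf_le)
      fix as
      show "measure_pmf.prob weights_pmf {r. (as, r) \<in> E2} \<le> 1 / (4 * real n)"
        unfolding E2_def using prob_ambiguous[OF chosen_mismatches_valid[OF s]] by simp
    qed
  qed
  finally show ?thesis by simp
qed

section \<open>Number of possible sketches\<close>

lemma level_le: "j < 2 * l \<Longrightarrow> level j \<le> 84 * k * l"
proof -
  assume j: "j < 2 * l"
  have "16 * k * (2 * l + 3) \<le> 16 * k * (5 * l)" using l_pos by (intro mult_left_mono) auto
  moreover have "2 * k * j \<le> 2 * k * (2 * l)" using j by (intro mult_left_mono) auto
  moreover have "16 * k * (5 * l) + 2 * k * (2 * l) = 84 * k * l" by simp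
  ultimately show ?thesis unfolding level_def by linarith
qed

lemma card_special_part_data:
  assumes "j < 2 * l"
  shows "card ((\<lambda>s. (level_gcd j s, special_part (level_gcd j s) s)) ` inputs) \<le> 2 ^ (l * l + 1344 * k * l ^ 3)"
    and "finite ((\<lambda>s. (level_gcd j s, special_part (level_gcd j s) s)) ` inputs)"
proof -
  let ?g = "\<lambda>s. (level_gcd j s, special_part (level_gcd j s) s)"
  show "finite (?g ` inputs)" unfolding level_gcd_def
    by (rule card_special_parts(2)[OF _ _ finite_lessThan n_pos n_less]) (auto simp: inputs_def)
  have "card (?g ` inputs) \<le> (n + 1) ^ l * (n * n * card {..<q} * card {..<q} + 1) ^ (l * level j)"
    unfolding level_gcd_def
    by (rule card_special_parts(1)[OF _ _ finite_lessThan n_pos n_less]) (auto simp: inputs_def)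
  also have "\<dots> = (n + 1) ^ l * (n * n * q * q + 1) ^ (l * level j)" by simp
  \<comment> \<open>A break takes at most 2 (l + 7 l) = 16 l bits, and there are at most l * level j
    <= 84 k l^2 of them.\<close>
  also have "\<dots> \<le> (2 ^ l) ^ l * (2 ^ (16 * l)) ^ (l * (84 * k * l))"
  proof (rule mult_mono)
    show "(n + 1) ^ l \<le> (2 ^ l) ^ l" using n_less by (intro power_mono) auto
    have "q > 0" by (simp add: q_def)
    then have "n * n * q * q + 1 \<le> (n + 1) * (n + 1) * q * q"
      by (simp add: algebra_simps Suc_le_eq)
    also have "\<dots> \<le> 2 ^ l * 2 ^ l * 2 ^ (7 * l) * 2 ^ (7 * l)"
      using n_less by (intro mult_mono) (auto simp: q_def)
    also have "\<dots> = 2 ^ (16 * l)" by (simp flip: power_add)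
    finally have "(n * n * q * q + 1) ^ (l * level j) \<le> (2 ^ (16 * l)) ^ (l * level j)" by (rule power_mono) simp
    also have "\<dots> \<le> (2 ^ (16 * l)) ^ (l * (84 * k * l))"
      using level_le[OF assms] by (intro power_increasing mult_left_mono) auto
    finally show "(n * n * q * q + 1) ^ (l * level j) \<le> (2 ^ (16 * l)) ^ (l * (84 * k * l))" .
  qed auto
  also have "\<dots> = 2 ^ (l * l + 16 * l * (l * (84 * k * l)))" by (simp only: power_add power_mult)
  also have "16 * l * (l * (84 * k * l)) = 1344 * k * l ^ 3" by (simp add: power3_eq_cube)
  finally show "card (?g ` inputs) \<le> 2 ^ (l * l + 1344 * k * l ^ 3)" .
qed

text \<open>A trial stores an anchor and a residue modulo N, together at most 22 l k bits, and the l
  + 2 trials are at most 3 l.\<close>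

lemma card_anchor_data: "(n * nat N) ^ (l + 2) \<le> 2 ^ (66 * k * l ^ 2)"
proof -
  have l: "l \<ge> 1" and k: "k \<ge> 1" using l_pos k_pos by auto
  have lk: "1 \<le> l * k" "l \<le> l * k" using l k by auto
  have "nat N = 2 ^ (20 * l * k) + 1" unfolding N_def by (simp add: nat_add_distrib nat_power_eq)
  also have "\<dots> \<le> 2 ^ (20 * l * k) + 2 ^ (20 * l * k)" by simp
  also have "\<dots> = 2 ^ (20 * l * k + 1)" by simp
  finally have "n * nat N \<le> 2 ^ l * 2 ^ (20 * l * k + 1)" using n_less by (intro mult_mono) auto
  also have "\<dots> = 2 ^ (l + (20 * l * k + 1))" by (simp only: power_add)
  also have "\<dots> \<le> 2 ^ (22 * l * k)"
    by (rule power_increasing) (use lk in linarith, simp)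
  finally have "(n * nat N) ^ (l + 2) \<le> (2 ^ (22 * l * k)) ^ (l + 2)" by (rule power_mono) simp
  also have "\<dots> \<le> (2 ^ (22 * l * k)) ^ (3 * l)" by (rule power_increasing) (use l in auto)
  also have "\<dots> = 2 ^ (22 * l * k * (3 * l))" by (simp only: power_mult)
  also have "22 * l * k * (3 * l) = 66 * k * l ^ 2" by (simp add: power2_eq_square)
  finally show ?thesis .
qed

text \<open>The bound is uniform in the randomness, so the length of the bit strings can be fixed
  before the draw.\<close>

lemma card_data:
  shows "card (data \<omega> ` inputs) \<le> 2 ^ (2822 * k * l ^ 4)" and "finite (data \<omega> ` inputs)"
proof -
  define X where "X j = (\<lambda>s. (level_gcd j s, special_part (level_gcd j s) s)) ` inputs" for j
  define Y where "Y = {..<l + 2} \<rightarrow>\<^sub>E ({0..<int n} \<times> {0..<N})"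
  have finX: "finite (X j)" if "j < 2 * l" for j unfolding X_def by (rule card_special_part_data(2)[OF that])
  have finY: "finite Y" unfolding Y_def by (intro finite_PiE) auto
  have cY: "card Y = (n * nat N) ^ (l + 2)"
    unfolding Y_def by (subst card_PiE) (simp_all add: card_cartesian_product)
  have sub: "data \<omega> ` inputs \<subseteq> (\<Pi>\<^sub>E j\<in>{..<2 * l}. X j \<times> Y)"
  proof
    fix D assume "D \<in> data \<omega> ` inputs"
    then obtain s where s: "s \<in> inputs" "D = data \<omega> s" by auto
    have "(\<lambda>\<tau>\<in>{..<l + 2}. (anchor n (fst \<omega> \<tau>) s,
       lin_sketch (snd \<omega>) (level_gcd j s) (anchor n (fst \<omega> \<tau>) s) (regular_part (level_gcd j s) s) mod N)) \<in> Y" for j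
      unfolding Y_def using anchor_spec(1)[OF n_pos] N_pos by (intro restrict_PiE_iff[THEN iffD2] ballI) simp
    then show "D \<in> (\<Pi>\<^sub>E j\<in>{..<2 * l}. X j \<times> Y)"
      unfolding s(2) data_def using s(1) by (intro restrict_PiE_iff[THEN iffD2] ballI) (simp add: X_def)
  qed
  have fin: "finite (\<Pi>\<^sub>E j\<in>{..<2 * l}. X j \<times> Y)" using finX finY by (intro finite_PiE) auto
  show "finite (data \<omega> ` inputs)" by (rule finite_subset[OF sub fin])
  have "card (data \<omega> ` inputs) \<le> card (\<Pi>\<^sub>E j\<in>{..<2 * l}. X j \<times> Y)" by (rule card_mono[OF fin sub])
  also have "\<dots> = (\<Prod>j\<in>{..<2 * l}. card (X j) * card Y)"
    by (subst card_PiE) (simp_all add: card_cartesian_product)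
  \<comment> \<open>1411 = 1 + 1344 + 66 collects the near-periods, the breaks and the anchor
    tables, each absorbed into k * l ^ 3. The 2 * l levels turn this into 2822 * k * l ^ 4.\<close>
  also have "\<dots> \<le> (\<Prod>j\<in>{..<2 * l}. 2 ^ (1411 * k * l ^ 3))"
  proof (rule prod_mono, intro conjI)
    fix j assume "j \<in> {..<2 * l}"
    then have "card (X j) \<le> 2 ^ (l * l + 1344 * k * l ^ 3)"
      unfolding X_def using card_special_part_data(1) by simp
    then have "card (X j) * card Y \<le> 2 ^ (l * l + 1344 * k * l ^ 3) * 2 ^ (66 * k * l ^ 2)"
      unfolding cY using card_anchor_data by (intro mult_mono) auto
    also have "\<dots> = 2 ^ (l * l + 1344 * k * l ^ 3 + 66 * k * l ^ 2)" by (simp only: power_add)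
    also have "\<dots> \<le> 2 ^ (1411 * k * l ^ 3)"
    proof (rule power_increasing)
      have "l ^ 2 \<le> l ^ 3" using l_pos by (intro power_increasing) auto
      then have "k * l ^ 2 \<le> k * l ^ 3" by simp
      moreover have "l * l \<le> k * l ^ 2" using k_pos by (simp add: power2_eq_square)
      ultimately have "l * l \<le> k * l ^ 3" "k * l ^ 2 \<le> k * l ^ 3" by linarith+
      then show "l * l + 1344 * k * l ^ 3 + 66 * k * l ^ 2 \<le> 1411 * k * l ^ 3"
        by (simp only: mult.assoc)
    qed simp
    finally show "card (X j) * card Y \<le> 2 ^ (1411 * k * l ^ 3)" .
  qed simp
  also have "\<dots> = (2 ^ (1411 * k * l ^ 3)) ^ (2 * l)" by simp
  also have "\<dots> = 2 ^ (1411 * k * l ^ 3 * (2 * l))" by (simp only: power_mult)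
  also have "1411 * k * l ^ 3 * (2 * l) = 2822 * k * l ^ 4" by (simp add: power4_eq_xxxx power3_eq_cube)
  finally show "card (data \<omega> ` inputs) \<le> 2 ^ (2822 * k * l ^ 4)" .
qed

end

section \<open>Letter hashing and bit encoding\<close>

text \<open>Reduction modulo q keeps hashed letters below q for every function, including those
  outside the support; on I the sampled functions are not changed by it.\<close>

lemma prob_hash_collision:
  fixes q :: nat
  assumes "finite I" "x \<in> I" "y \<in> I" "x \<noteq> y" "q > 0"
  shows "measure_pmf.prob (pmf_of_set (I \<rightarrow>\<^sub>E {..<q})) {\<phi>. \<phi> x mod q = \<phi> y mod q} \<le> 1 / real q"
proof -
  define \<Omega> where "\<Omega> = I \<rightarrow>\<^sub>E {..<q}"
  define B where "B = {\<phi> \<in> \<Omega>. \<phi> x mod q = \<phi> y mod q}"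
  have lt: "\<phi> i < q" if "\<phi> \<in> \<Omega>" "i \<in> I" for \<phi> i using that unfolding \<Omega>_def by blast
  have "card B \<le> card {..<q} ^ (card I - 1)"
  proof (rule card_PiE_determined_coordinate[OF assms(1,2)])
    fix \<phi> v assume "\<phi> \<in> B" "\<phi>(x := v) \<in> B"
    then have b: "\<phi> \<in> \<Omega>" "\<phi>(x := v) \<in> \<Omega>" "\<phi> x mod q = \<phi> y mod q" "v mod q = \<phi> y mod q"
      using assms(4) by (auto simp: B_def)
    have "\<phi> x < q" "v < q" using lt[OF b(1) assms(2)] lt[OF b(2) assms(2)] by simp_all
    then show "v = \<phi> x" using b(3,4) by simp
  qed (auto simp: B_def \<Omega>_def)
  then have B: "card B \<le> q ^ (card I - 1)" by simp
  have "card I > 0" using assms(1,2) by (auto simp: card_gt_0_iff)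
  moreover have "card \<Omega> = q ^ card I" unfolding \<Omega>_def card_PiE[OF assms(1)] by simp
  ultimately have \<Omega>: "card \<Omega> = q * q ^ (card I - 1)" by (simp add: power_eq_if)
  then have "card \<Omega> > 0" using assms(5) by simp
  then have ne: "\<Omega> \<noteq> {}" "finite \<Omega>" by (auto simp: card_gt_0_iff)
  have "measure_pmf.prob (pmf_of_set \<Omega>) {\<phi>. \<phi> x mod q = \<phi> y mod q} = card B / card \<Omega>"
    using ne by (simp add: measure_pmf_of_set B_def Int_def)
  also have "\<dots> \<le> real (q ^ (card I - 1)) / card \<Omega>"
    using B by (intro divide_right_mono) (simp_all only: of_nat_le_iff of_nat_0_le_iff)
  also have "\<dots> = 1 / real q" unfolding \<Omega> using assms(5) by simp
  finally show ?thesis unfolding \<Omega>_def .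
qed

text \<open>The union bound runs over pairs of letters in X only, so the size of the alphabet does
  not enter.\<close>

lemma prob_hash_not_inj:
  fixes q :: nat
  assumes "finite I" "X \<subseteq> I" "q > 0"
  shows "measure_pmf.prob (pmf_of_set (I \<rightarrow>\<^sub>E {..<q})) {\<phi>. \<not> inj_on (\<lambda>x. \<phi> x mod q) X} \<le> real (card X ^ 2) / real q"
proof -
  let ?p = "pmf_of_set (I \<rightarrow>\<^sub>E {..<q})"
  define P where "P = {(x, y). x \<in> X \<and> y \<in> X \<and> x \<noteq> y}"
  have P: "P \<subseteq> X \<times> X" by (auto simp: P_def)
  have finX: "finite X" by (rule finite_subset[OF assms(2,1)])
  have finP: "finite P" by (rule finite_subset[OF P]) (use finX in simp)
  have "card P \<le> card (X \<times> X)" by (rule card_mono[OF _ P]) (use finX in simp)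
  then have cP: "card P \<le> card X ^ 2" by (simp add: card_cartesian_product power2_eq_square)
  have "measure_pmf.prob ?p {\<phi>. \<not> inj_on (\<lambda>x. \<phi> x mod q) X}
      \<le> measure_pmf.prob ?p (\<Union>z\<in>P. {\<phi>. \<phi> (fst z) mod q = \<phi> (snd z) mod q})"
    by (rule measure_pmf.finite_measure_mono) (auto simp: P_def inj_on_def)
  also have "\<dots> \<le> (\<Sum>z\<in>P. measure_pmf.prob ?p {\<phi>. \<phi> (fst z) mod q = \<phi> (snd z) mod q})"
    by (rule measure_pmf.finite_measure_subadditive_finite) (use finP in auto)
  also have "\<dots> \<le> (\<Sum>z\<in>P. 1 / real q)"
    by (intro sum_mono prob_hash_collision[OF assms(1)]) (use assms in \<open>auto simp: P_def\<close>)
  also have "\<dots> = real (card P) / real q" by simp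
  also have "\<dots> \<le> real (card X ^ 2) / real q"
    using cP by (intro divide_right_mono) (simp_all only: of_nat_le_iff of_nat_0_le_iff)
  finally show ?thesis .
qed

lemma cyc_fun_map: "S \<noteq> [] \<Longrightarrow> cyc_fun (map f S) x = f (cyc_fun S x)"
  unfolding cyc_fun_def by (simp add: nat_less_iff)

lemma cyc_ham_comp_inj:
  assumes "inj_on f X" "\<And>x. s\<^sub>1 x \<in> X" "\<And>x. s\<^sub>2 x \<in> X"
  shows "cyc_ham n (\<lambda>x. f (s\<^sub>1 x)) (\<lambda>x. f (s\<^sub>2 x)) = cyc_ham n s\<^sub>1 s\<^sub>2"
  unfolding cyc_ham_def using inj_on_eq_iff[OF assms(1)] assms(2,3) by simp

section \<open>From finitely many data to bit strings\<close>

lemma ex_bit_encoding: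
  assumes "finite D" "card D \<le> 2 ^ b"
  shows "\<exists>f :: 'd \<Rightarrow> bool list. inj_on f D \<and> (\<forall>x\<in>D. length (f x) = b)"
proof -
  let ?B = "{bs :: bool list. set bs \<subseteq> UNIV \<and> length bs = b}"
  have "finite ?B" by (rule finite_lists_length_eq) simp
  moreover have "card ?B = 2 ^ b" by (subst card_lists_length_eq) auto
  ultimately obtain f where f: "f ` D \<subseteq> ?B" "inj_on f D" using card_le_inj[of D ?B] assms by auto
  then have "\<forall>x\<in>D. length (f x) = b" by blast
  then show ?thesis using f(2) by blast
qed

text \<open>As the randomness is shared, the encoding of the data by b bits may depend on the draw
  and the decoder can still invert it. For n = 1 the required probability 1 - 1 / n is 0, so any
  size bound holds.\<close>

lemma ex_ECS_from_data:
  fixes p :: "'w pmf" and data :: "'w \<Rightarrow> nat list \<Rightarrow> 'd"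
    and decode :: "'w \<Rightarrow> 'd \<Rightarrow> 'd \<Rightarrow> int \<Rightarrow> nat"
  assumes fin: "\<And>\<omega>. finite (data \<omega> ` P)" and card: "\<And>\<omega>. card (data \<omega> ` P) \<le> 2 ^ b"
    and n: "n > 0" and B: "n = 1 \<or> real b \<le> B"
    and err: "\<And>S\<^sub>1 S\<^sub>2 m. S\<^sub>1 \<in> P \<Longrightarrow> S\<^sub>2 \<in> P \<Longrightarrow> measure_pmf.prob p
      {\<omega>. \<not> (if Ham S\<^sub>1 (cyc_pow m S\<^sub>2) \<le> k then decode \<omega> (data \<omega> S\<^sub>1) (data \<omega> S\<^sub>2) m = Ham S\<^sub>1 (cyc_pow m S\<^sub>2)
           else decode \<omega> (data \<omega> S\<^sub>1) (data \<omega> S\<^sub>2) m > k)} \<le> 1 / real n"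
  shows "\<exists>(M :: nat coder_pair measure) sk dec. ECS 1 n k P M sk dec \<and> sketch_size 1 n P M sk B"
proof -
  have "\<exists>f :: 'd \<Rightarrow> bool list. inj_on f (data \<omega> ` P) \<and> (\<forall>x\<in>data \<omega> ` P. length (f x) = b)" for \<omega>
    by (rule ex_bit_encoding[OF fin card])
  then obtain enc :: "'w \<Rightarrow> 'd \<Rightarrow> bool list" where enc: "\<And>\<omega>. inj_on (enc \<omega>) (data \<omega> ` P)"
    "\<And>\<omega> x. x \<in> data \<omega> ` P \<Longrightarrow> length (enc \<omega> x) = b" by metis
  define unenc where "unenc \<omega> = inv_into (data \<omega> ` P) (enc \<omega>)" for \<omega>
  have unenc: "unenc \<omega> (enc \<omega> (data \<omega> S)) = data \<omega> S" if "S \<in> P" for \<omega> S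
    unfolding unenc_def using that by (intro inv_into_f_f enc) auto
  define sk where "sk \<omega> S = enc \<omega> (data \<omega> S)" for \<omega> S
  define dec where "dec \<omega> = (\<lambda>(x, y, m). decode \<omega> (unenc \<omega> x) (unenc \<omega> y) m)" for \<omega>
  \<comment> \<open>The law of the coder pair is discrete with all sets measurable, so both
    projections are randomized functions.\<close>
  define M where "M = map_pmf (\<lambda>\<omega>. (sk \<omega>, dec \<omega>)) p"
  have powr: "real n powr - 1 = 1 / real n" using n by (simp add: powr_minus_divide)
  have whp: "whp 1 n (measure_pmf M) E" if "measure_pmf.prob p {\<omega>. \<not> E (sk \<omega>, dec \<omega>)} \<le> 1 / real n" for E
  proof -
    have "measure_pmf.prob M {z. E z} = measure_pmf.prob p {\<omega>. E (sk \<omega>, dec \<omega>)}"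
      unfolding M_def measure_map_pmf by (simp add: vimage_def)
    also have "\<dots> = 1 - measure_pmf.prob p {\<omega>. \<not> E (sk \<omega>, dec \<omega>)}"
      by (subst measure_pmf.prob_compl[symmetric]) (auto intro!: arg_cong[where f = "measure_pmf.prob p"])
    finally show ?thesis using that unfolding whp_def powr by simp
  qed
  have ps: "prob_space (measure_pmf M)" by (rule prob_space_measure_pmf)
  have "ECS 1 n k P (measure_pmf M) fst snd"
    unfolding ECS_def randomized_function_def
  proof (intro conjI ballI allI ps)
    fix S\<^sub>1 S\<^sub>2 and m :: int assume S: "S\<^sub>1 \<in> P" "S\<^sub>2 \<in> P"
    show "whp 1 n (measure_pmf M) (\<lambda>\<omega>. if Ham S\<^sub>1 (cyc_pow m S\<^sub>2) \<le> k
        then snd \<omega> (fst \<omega> S\<^sub>1, fst \<omega> S\<^sub>2, m) = Ham S\<^sub>1 (cyc_pow m S\<^sub>2)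
        else k < snd \<omega> (fst \<omega> S\<^sub>1, fst \<omega> S\<^sub>2, m))"
      by (rule whp) (use err[OF S, of m] in
          \<open>simp only: dec_def sk_def fst_conv snd_conv prod.case unenc[OF S(1)] unenc[OF S(2)]\<close>)
  qed simp_all
  moreover have "sketch_size 1 n P (measure_pmf M) fst B"
    unfolding sketch_size_def
  proof
    fix S assume S: "S \<in> P"
    show "whp 1 n (measure_pmf M) (\<lambda>\<omega>. real (length (fst \<omega> S)) \<le> B)"
    proof (rule whp)
      show "measure_pmf.prob p {\<omega>. \<not> real (length (fst (sk \<omega>, dec \<omega>) S)) \<le> B} \<le> 1 / real n"
        using B enc(2)[OF imageI[OF S]] by (auto simp: sk_def)
    qed
  qed
  ultimately show ?thesis by blast
qed

text \<open>Random hashing reduces the alphabet to q letters, because sigma is not bounded in terms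
  of n. If the at most 2n letters of the two strings are hashed injectively, the Hamming distance is
  preserved for every rotation.\<close>

lemma (in circular_sketch) ex_ECS:
  fixes \<sigma> :: nat
  assumes "n = 1 \<or> real (2822 * k * l ^ 4) \<le> B"
  shows "\<exists>(M :: nat coder_pair measure) sk dec.
    ECS 1 n k (strings {1..\<sigma>} n) M sk dec \<and> sketch_size 1 n (strings {1..\<sigma>} n) M sk B"
proof -
  let ?H = "pmf_of_set ({1..\<sigma>} \<rightarrow>\<^sub>E {..<q})" and ?Q = "pair_pmf anchors_pmf weights_pmf"
  define hash where "hash \<phi> S = cyc_fun (map (\<lambda>x. \<phi> x mod q) S)" for \<phi> :: "nat \<Rightarrow> nat" and S
  have q_pos: "q > 0" by (simp add: q_def)
  have str: "length S = n" "S \<noteq> []" "set S \<subseteq> {1..\<sigma>}" if "S \<in> strings {1..\<sigma>} n" for S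
    using that n_pos by (auto simp: strings_def)
  have inp: "hash \<phi> S \<in> inputs" if S: "S \<in> strings {1..\<sigma>} n" for \<phi> S
    using periodic_cyc_fun[of "map (\<lambda>x. \<phi> x mod q) S"] q_pos
    by (simp add: inputs_def hash_def cyc_fun_map[OF str(2)[OF S]] str(1)[OF S])
  have sub: "(\<lambda>S. data \<omega> (hash \<phi> S)) ` strings {1..\<sigma>} n \<subseteq> data \<omega> ` inputs" for \<phi> \<omega>
    using inp by blast
  show ?thesis
  proof (rule ex_ECS_from_data[where p = "pair_pmf ?H ?Q" and b = "2822 * k * l ^ 4"
        and data = "\<lambda>\<omega> S. data (snd \<omega>) (hash (fst \<omega>) S)" and decode = "\<lambda>\<omega>. decode (snd (snd \<omega>))", OF _ _ n_pos assms])
    fix \<omega> :: "(nat \<Rightarrow> nat) \<times> _"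
    show "finite ((\<lambda>S. data (snd \<omega>) (hash (fst \<omega>) S)) ` strings {1..\<sigma>} n)"
      by (rule finite_subset[OF sub card_data(2)])
    show "card ((\<lambda>S. data (snd \<omega>) (hash (fst \<omega>) S)) ` strings {1..\<sigma>} n) \<le> 2 ^ (2822 * k * l ^ 4)"
      by (rule order_trans[OF card_mono[OF card_data(2) sub] card_data(1)])
  next
    fix S\<^sub>1 S\<^sub>2 and m :: int assume S: "S\<^sub>1 \<in> strings {1..\<sigma>} n" "S\<^sub>2 \<in> strings {1..\<sigma>} n"
    let ?h = "Ham S\<^sub>1 (cyc_pow m S\<^sub>2)"
    define X where "X = set S\<^sub>1 \<union> set S\<^sub>2"
    define ok where "ok \<phi> \<omega> = correct ?h (decode (snd \<omega>) (data \<omega> (hash \<phi> S\<^sub>1)) (data \<omega> (hash \<phi> S\<^sub>2)) m)" for \<phi> \<omega>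
    define E1 where "E1 = {\<phi>. \<not> inj_on (\<lambda>x. \<phi> x mod q) X}"
    \<comment> \<open>Leaving out the hash collisions makes E2, for a fixed hash function, either
      empty or the failure event of \<open>prob_incorrect\<close> for the hashed strings.\<close>
    define E2 where "E2 = {z. fst z \<notin> E1 \<and> \<not> ok (fst z) (snd z)}"
    have ham: "?h = cyc_ham (int n) (hash \<phi> S\<^sub>1) (shift_by m (hash \<phi> S\<^sub>2))" if "\<phi> \<notin> E1" for \<phi>
    proof -
      let ?f = "\<lambda>x. \<phi> x mod q"
      have "cyc_ham (int n) (\<lambda>x. ?f (cyc_fun S\<^sub>1 x)) (\<lambda>x. ?f (shift_by m (cyc_fun S\<^sub>2) x))
          = cyc_ham (int n) (cyc_fun S\<^sub>1) (shift_by m (cyc_fun S\<^sub>2))"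
      proof (rule cyc_ham_comp_inj)
        show "inj_on ?f X" using that by (simp add: E1_def)
      qed (use cyc_fun_in_set[OF str(2)[OF S(1)]] cyc_fun_in_set[OF str(2)[OF S(2)]] in
          \<open>auto simp: X_def shift_by_def\<close>)
      moreover have "hash \<phi> S\<^sub>1 = (\<lambda>x. ?f (cyc_fun S\<^sub>1 x))"
        "shift_by m (hash \<phi> S\<^sub>2) = (\<lambda>x. ?f (shift_by m (cyc_fun S\<^sub>2) x))"
        using str(2) S by (simp_all add: hash_def fun_eq_iff shift_by_def cyc_fun_map)
      ultimately show ?thesis using Ham_cyc_pow[OF str(1)[OF S(1)] str(1)[OF S(2)] n_pos] by simp
    qed
    have "measure_pmf.prob ?H E1 \<le> real (card X ^ 2) / real q"
      unfolding E1_def using str(3)[OF S(1)] str(3)[OF S(2)]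
      by (intro prob_hash_not_inj q_pos) (auto simp: X_def)
    also have "\<dots> \<le> 1 / (2 * real n)"
    proof -
      have "card X \<le> card (set S\<^sub>1) + card (set S\<^sub>2)" unfolding X_def by (rule card_Un_le)
      also have "\<dots> \<le> 2 * n"
        using card_length[of S\<^sub>1] card_length[of S\<^sub>2] str(1)[OF S(1)] str(1)[OF S(2)] by simp
      finally have "card X ^ 2 \<le> (2 * n) ^ 2" by (rule power_mono) simp
      then have "2 * n * card X ^ 2 \<le> 2 * n * (2 * n) ^ 2" by (rule mult_left_mono) simp
      also have "\<dots> = 8 * n ^ 3" by (simp add: power2_eq_square power3_eq_cube)
      also have "\<dots> \<le> 8 * (2 ^ l) ^ 3" using n_less by (intro mult_left_mono power_mono) auto
      also have "\<dots> = 2 ^ (3 + 3 * l)" by (simp add: power_add mult.commute flip: power_mult)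
      also have "\<dots> \<le> q" unfolding q_def using l_pos by (intro power_increasing) auto
      finally have "real (2 * n * card X ^ 2) \<le> real q" by (simp only: of_nat_le_iff)
      then show ?thesis using n_pos q_pos by (simp add: field_simps)
    qed
    finally have e1: "measure_pmf.prob (pair_pmf ?H ?Q) {z. fst z \<in> E1} \<le> 1 / (2 * real n)"
      by (simp only: prob_pair_pmf_fst)
    have e2: "measure_pmf.prob (pair_pmf ?H ?Q) E2 \<le> 1 / (2 * real n)"
    proof (rule prob_pair_pmf_le)
      fix \<phi>
      show "measure_pmf.prob ?Q {\<omega>. (\<phi>, \<omega>) \<in> E2} \<le> 1 / (2 * real n)"
      proof (cases "\<phi> \<in> E1")
        case True
        then show ?thesis by (simp add: E2_def)
      next
        case False
        then show ?thesis
          using prob_incorrect[OF inp[OF S(1), of \<phi>] inp[OF S(2), of \<phi>], of m]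
          by (simp add: E2_def ok_def ham[OF False])
      qed
    qed
    have "measure_pmf.prob (pair_pmf ?H ?Q) {z. \<not> ok (fst z) (snd z)}
        \<le> measure_pmf.prob (pair_pmf ?H ?Q) ({z. fst z \<in> E1} \<union> E2)"
      by (rule measure_pmf.finite_measure_mono) (auto simp: E2_def)
    also have "\<dots> \<le> measure_pmf.prob (pair_pmf ?H ?Q) {z. fst z \<in> E1} + measure_pmf.prob (pair_pmf ?H ?Q) E2"
      by (rule measure_Un_le) auto
    also have "\<dots> \<le> 1 / (2 * real n) + 1 / (2 * real n)" by (rule add_mono[OF e1 e2])
    also have "\<dots> = 1 / real n" by simp
    finally show "measure_pmf.prob (pair_pmf ?H ?Q)
        {\<omega>. \<not> (if ?h \<le> k
          then decode (snd (snd \<omega>)) (data (snd \<omega>) (hash (fst \<omega>) S\<^sub>1)) (data (snd \<omega>) (hash (fst \<omega>) S\<^sub>2)) m = ?h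
          else k < decode (snd (snd \<omega>)) (data (snd \<omega>) (hash (fst \<omega>) S\<^sub>1)) (data (snd \<omega>) (hash (fst \<omega>) S\<^sub>2)) m)}
      \<le> 1 / real n"
      unfolding ok_def correct_def .
  qed
qed

theorem theorem1:
  "\<exists>c>0. \<exists>C::real. \<exists>d::nat. \<forall>(\<sigma>::nat) (n::nat) (k::nat). 1 \<le> k \<and> k \<le> n \<longrightarrow>
     (\<exists>(M :: nat coder_pair measure) sk dec.
        ECS c n k (strings {1..\<sigma>} n) M sk dec \<and>
        sketch_size c n (strings {1..\<sigma>} n) M sk (C * real k * log 2 (real n) ^ d))"
proof (rule exI[of _ 1], rule conjI, simp, rule exI[of _ 45152], rule exI[of _ 4], intro allI impI)
  fix \<sigma> n k :: nat assume k: "1 \<le> k \<and> k \<le> n"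
  \<comment> \<open>The bit length of n: adding 1 to the floor gives n < 2 ^ l also when n is a
    power of two.\<close>
  define l where "l = nat \<lfloor>log 2 (real n)\<rfloor> + 1"
  have log: "0 \<le> log 2 (real n)" using k by simp
  have l: "real l \<le> log 2 (real n) + 1" "log 2 (real n) < real l" unfolding l_def using log by linarith+
  have "real n = 2 powr log 2 (real n)" using k by simp
  also have "\<dots> < 2 powr real l" using l(2) by simp
  finally have "real n < real (2 ^ l)" by (simp add: powr_realpow)
  then have "n < 2 ^ l" by (simp only: of_nat_less_iff)
  then interpret circular_sketch n k l using k by unfold_locales auto
  \<comment> \<open>For n = 1 the logarithm is 0 and the size bound collapses to 0; there the
    probability requirement is trivial.\<close>
  have "n = 1 \<or> real (2822 * k * l ^ 4) \<le> 45152 * real k * log 2 (real n) ^ 4"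
  proof (cases "n = 1")
    case False
    then have "1 \<le> log 2 (real n)" using k by simp
    then have "real l \<le> 2 * log 2 (real n)" using l by linarith
    \<comment> \<open>Replacing l by 2 log n multiplies 2822 by 16, which gives 45152.\<close>
    then have "real l ^ 4 \<le> (2 * log 2 (real n)) ^ 4" by (rule power_mono) simp
    then have "2822 * real k * real l ^ 4 \<le> 2822 * real k * (2 * log 2 (real n)) ^ 4"
      by (rule mult_left_mono) simp
    then show ?thesis by (simp add: power_mult_distrib)
  qed simp
  then show "\<exists>(M :: nat coder_pair measure) sk dec. ECS 1 n k (strings {1..\<sigma>} n) M sk dec \<and>
      sketch_size 1 n (strings {1..\<sigma>} n) M sk (45152 * real k * log 2 (real n) ^ 4)"
    by (rule ex_ECS)
qed

end
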